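(* For all operator spaces $V$ and $W$, $\|\cdot\|_s$ is an operator space matrix norm on $V\otimes W$; that is, $\|\cdot\|_s$ is a norm on $M_p(V\otimes W)$ for each $p\in\mathbb{N}$, and for all $m,n,p\in\mathbb{N}$, $u_1\in M_m(V\otimes W)$, $u_2\in M_n(V\otimes W)$, $\gamma\in M_{p,m}(\mathbb{C})$, $\delta\in M_{m,p}(\mathbb{C})$ one has $\|u_1\oplus u_2\|_s=\max\{\|u_1\|_s,\|u_2\|_s\}$ and $\|\gamma u_1\delta\|_s\le\|\gamma\|\,\|u_1\|_s\,\|\delta\|$.
   Context: An operator space is a closed subspace of $B(H)$ for a Hilbert space $H$, with the matrix norms on $M_n(V)$ inherited from $M_n(B(H))=B(H^n)$. $V\otimes W$ is the algebraic tensor product, and $M_{p,n}=M_{p,n}(\mathbb{C})$ has the operator norm. For $x=[x_{ij}]\in M_n(V)$ and $y=[y_{ij}]\in M_n(W)$ put $x\circ y=[x_{ij}\otimes y_{ij}]\in M_n(V\otimes W)$. Every $u\in M_p(V\otimes W)$ can be written as $u=\alpha(x\circ y)\beta$ with $n\in\mathbb{N}$, $x\in M_n(V)$, $y\in M_n(W)$, $\alpha\in M_{p,n}$, $\beta\in M_{n,p}$, and the schur tensor norm is $\|u\|_s=\inf\{\|\alpha\|\|x\|\|y\|\|\beta\|\}$, the infimum over all such decompositions (with $n$ arbitrary). *)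

theory Defs
  imports "HOL-Analysis.Analysis" "HOL-Library.Poly_Mapping" "Jordan_Normal_Form.Matrix"
begin

no_notation vec_nth (infixl "$" 90)
hide_const (open) Finite_Cartesian_Product.vec Finite_Cartesian_Product.mat
  Determinants.det Finite_Cartesian_Product.row Finite_Cartesian_Product.transpose

class complex_vector = real_vector +
  fixes scaleC :: "complex \<Rightarrow> 'a \<Rightarrow> 'a"  (infixr "*\<^sub>C" 75)
  assumes scaleC_add_right: "a *\<^sub>C (x + y) = a *\<^sub>C x + a *\<^sub>C y"
    and scaleC_add_left: "(a + b) *\<^sub>C x = a *\<^sub>C x + b *\<^sub>C x"
    and scaleC_scaleC: "a *\<^sub>C b *\<^sub>C x = (a * b) *\<^sub>C x"
    and scaleR_scaleC: "scaleR r x = complex_of_real r *\<^sub>C x"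

text \<open>The norm is the one induced by the inner product, so the triangle inequality
  contained in \<^class>\<open>banach\<close> is redundant; the class \<^class>\<open>banach\<close> contributes completeness
  and gives access to the type of bounded operators of the library.\<close>

class chilbert_space = banach + complex_vector +
  fixes cinner :: "'a \<Rightarrow> 'a \<Rightarrow> complex"
  assumes cinner_commute: "cinner x y = cnj (cinner y x)"
    and cinner_add_left: "cinner (x + y) z = cinner x z + cinner y z"
    and cinner_scaleC_left: "cinner (a *\<^sub>C x) y = a * cinner x y"
    and norm_eq_sqrt_cinner: "norm x = sqrt (Re (cinner x x))"

lemma norm_scaleC: "norm (a *\<^sub>C x) = cmod a * norm (x :: 'a :: chilbert_space)"
proof -
  have "cinner (a *\<^sub>C x) (a *\<^sub>C x) = a * cinner x (a *\<^sub>C x)"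
    by (rule cinner_scaleC_left)
  also have "cinner x (a *\<^sub>C x) = cnj a * cinner x x"
    by (metis cinner_commute cinner_scaleC_left complex_cnj_mult)
  finally have "cinner (a *\<^sub>C x) (a *\<^sub>C x) = complex_of_real ((cmod a)\<^sup>2) * cinner x x"
    by (simp only: complex_norm_square mult.assoc)
  then show ?thesis
    by (simp add: norm_eq_sqrt_cinner real_sqrt_mult del: of_real_power)
qed

instantiation blinfun :: (real_normed_vector, chilbert_space) complex_vector
begin

lift_definition scaleC_blinfun :: "complex \<Rightarrow> ('a \<Rightarrow>\<^sub>L 'b) \<Rightarrow> 'a \<Rightarrow>\<^sub>L 'b" is
  "\<lambda>c f x. c *\<^sub>C f x"
proof -
  fix c :: complex and f :: "'a \<Rightarrow> 'b"
  assume "bounded_linear f"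
  then interpret bounded_linear f .
  have "c *\<^sub>C r *\<^sub>R y = r *\<^sub>R c *\<^sub>C y" for r and y :: 'b
    by (simp add: scaleR_scaleC scaleC_scaleC mult.commute)
  moreover obtain K where "\<And>x. norm (f x) \<le> norm x * K"
    using bounded by blast
  then have "norm (c *\<^sub>C f x) \<le> norm x * (cmod c * K)" for x
    by (metis norm_scaleC mult.left_commute mult_left_mono norm_ge_zero)
  ultimately show "bounded_linear (\<lambda>x. c *\<^sub>C f x)"
    by unfold_locales (auto simp: add scale scaleC_add_right)
qed

instance
  by standard
    (transfer; simp add: scaleC_add_right scaleC_add_left scaleC_scaleC scaleR_scaleC fun_eq_iff)+

end

text \<open>The type \<^typ>\<open>'h \<Rightarrow>\<^sub>L 'h\<close> consists of the bounded \<^emph>\<open>real\<close>-linear maps; the elements of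
  $B(H)$ are the complex-linear ones among them, with the norm of that type.\<close>

definition bounded_operators :: "('h :: chilbert_space \<Rightarrow>\<^sub>L 'h) set" where
  "bounded_operators =
    {T. \<forall>c x. blinfun_apply T (c *\<^sub>C x) = c *\<^sub>C blinfun_apply T x}"

definition operator_space :: "('h :: chilbert_space \<Rightarrow>\<^sub>L 'h) set \<Rightarrow> bool" where
  "operator_space V \<longleftrightarrow>
    V \<subseteq> bounded_operators \<and> module.subspace (*\<^sub>C) V \<and> closed V"

definition matrices :: "nat \<Rightarrow> 'a set \<Rightarrow> 'a mat set" where
  "matrices n S = {A \<in> carrier_mat n n. elements_mat A \<subseteq> S}"

definition hnorm :: "'a :: real_normed_vector vec \<Rightarrow> real" where
  "hnorm \<xi> = L2_set (\<lambda>i. norm (\<xi> $ i)) {..<dim_vec \<xi>}"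

text \<open>Operator norms $\mathbb{C}^n \to \mathbb{C}^p$ and $H^n \to H^n$ with respect to the Hilbert space
  norms of the direct sums.\<close>

definition cmat_norm :: "complex mat \<Rightarrow> real" where
  "cmat_norm \<alpha> = (SUP \<xi>\<in>{\<xi> \<in> carrier_vec (dim_col \<alpha>). hnorm \<xi> \<le> 1}. hnorm (\<alpha> *\<^sub>v \<xi>))"

definition opmat_apply ::
  "('h :: chilbert_space \<Rightarrow>\<^sub>L 'h) mat \<Rightarrow> 'h vec \<Rightarrow> 'h vec" where
  "opmat_apply x \<xi> =
    vec (dim_row x) (\<lambda>i. \<Sum>j<dim_col x. blinfun_apply (x $$ (i, j)) (\<xi> $ j))"

definition opmat_norm :: "('h :: chilbert_space \<Rightarrow>\<^sub>L 'h) mat \<Rightarrow> real" where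
  "opmat_norm x = (SUP \<xi>\<in>{\<xi> \<in> carrier_vec (dim_col x). hnorm \<xi> \<le> 1}. hnorm (opmat_apply x \<xi>))"

text \<open>$V \otimes W$ is the free complex vector space on the set $V \times W$ modulo the subspace
  spanned by the bilinearity relations. The ambient vector spaces of \<open>V\<close> and \<open>W\<close>
  enter only through their operations.\<close>

definition formal_scale :: "complex \<Rightarrow> ('x \<Rightarrow>\<^sub>0 complex) \<Rightarrow> 'x \<Rightarrow>\<^sub>0 complex" where
  "formal_scale c = Poly_Mapping.map ((*) c)"

definition formal_sums :: "'a set \<Rightarrow> 'b set \<Rightarrow> ('a \<times> 'b \<Rightarrow>\<^sub>0 complex) set" where
  "formal_sums V W = {f. Poly_Mapping.keys f \<subseteq> V \<times> W}"

abbreviation formal_pair :: "'a \<Rightarrow> 'b \<Rightarrow> 'a \<times> 'b \<Rightarrow>\<^sub>0 complex" where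
  "formal_pair v w \<equiv> Poly_Mapping.single (v, w) 1"

definition bilinear_relations ::
  "'a :: complex_vector set \<Rightarrow> 'b :: complex_vector set \<Rightarrow> ('a \<times> 'b \<Rightarrow>\<^sub>0 complex) set" where
  "bilinear_relations V W =
    {formal_pair (v + v') w - formal_pair v w - formal_pair v' w | v v' w.
        v \<in> V \<and> v' \<in> V \<and> w \<in> W} \<union>
    {formal_pair v (w + w') - formal_pair v w - formal_pair v w' | v w w'.
        v \<in> V \<and> w \<in> W \<and> w' \<in> W} \<union>
    {formal_pair (c *\<^sub>C v) w - formal_scale c (formal_pair v w) | c v w. v \<in> V \<and> w \<in> W} \<union>
    {formal_pair v (c *\<^sub>C w) - formal_scale c (formal_pair v w) | c v w. v \<in> V \<and> w \<in> W}"

definition tensor_rel ::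
  "'a :: complex_vector set \<Rightarrow> 'b :: complex_vector set \<Rightarrow> ('a \<times> 'b \<Rightarrow>\<^sub>0 complex) rel" where
  "tensor_rel V W = {(f, g). f \<in> formal_sums V W \<and> g \<in> formal_sums V W \<and>
    f - g \<in> module.span formal_scale (bilinear_relations V W)}"

type_synonym ('a, 'b) tensor = "('a \<times> 'b \<Rightarrow>\<^sub>0 complex) set"

definition tensor_product ::
  "'a :: complex_vector set \<Rightarrow> 'b :: complex_vector set \<Rightarrow> ('a, 'b) tensor set" where
  "tensor_product V W = formal_sums V W // tensor_rel V W"

definition elem_tensor ::
  "'a :: complex_vector set \<Rightarrow> 'b :: complex_vector set \<Rightarrow> 'a \<Rightarrow> 'b \<Rightarrow> ('a, 'b) tensor" where
  "elem_tensor V W v w = tensor_rel V W `` {formal_pair v w}"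

text \<open>Vector space operations on classes, following the idiom of \<^theory>\<open>HOL.Equiv_Relations\<close>:
  the sets united are all equal.\<close>

definition tensor_zero ::
  "'a :: complex_vector set \<Rightarrow> 'b :: complex_vector set \<Rightarrow> ('a, 'b) tensor" where
  "tensor_zero V W = tensor_rel V W `` {0}"

definition tensor_add ::
  "'a :: complex_vector set \<Rightarrow> 'b :: complex_vector set \<Rightarrow>
    ('a, 'b) tensor \<Rightarrow> ('a, 'b) tensor \<Rightarrow> ('a, 'b) tensor" where
  "tensor_add V W s t = (\<Union>f\<in>s. \<Union>g\<in>t. tensor_rel V W `` {f + g})"

definition tensor_scale ::
  "'a :: complex_vector set \<Rightarrow> 'b :: complex_vector set \<Rightarrow>
    complex \<Rightarrow> ('a, 'b) tensor \<Rightarrow> ('a, 'b) tensor" where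
  "tensor_scale V W c t = (\<Union>f\<in>t. tensor_rel V W `` {formal_scale c f})"

definition tensor_sum ::
  "'a :: complex_vector set \<Rightarrow> 'b :: complex_vector set \<Rightarrow>
    ('i \<Rightarrow> ('a, 'b) tensor) \<Rightarrow> 'i set \<Rightarrow> ('a, 'b) tensor" where
  "tensor_sum V W t I = (\<Union>f\<in>Pi I t. tensor_rel V W `` {\<Sum>i\<in>I. f i})"

definition tmat_zero ::
  "'a :: complex_vector set \<Rightarrow> 'b :: complex_vector set \<Rightarrow> nat \<Rightarrow> nat \<Rightarrow> ('a, 'b) tensor mat" where
  "tmat_zero V W m n = mat m n (\<lambda>_. tensor_zero V W)"

definition tmat_add ::
  "'a :: complex_vector set \<Rightarrow> 'b :: complex_vector set \<Rightarrow>
    ('a, 'b) tensor mat \<Rightarrow> ('a, 'b) tensor mat \<Rightarrow> ('a, 'b) tensor mat" where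
  "tmat_add V W u u' =
    mat (dim_row u) (dim_col u) (\<lambda>ij. tensor_add V W (u $$ ij) (u' $$ ij))"

definition tmat_scale ::
  "'a :: complex_vector set \<Rightarrow> 'b :: complex_vector set \<Rightarrow>
    complex \<Rightarrow> ('a, 'b) tensor mat \<Rightarrow> ('a, 'b) tensor mat" where
  "tmat_scale V W c u = map_mat (tensor_scale V W c) u"

definition tmat_dsum ::
  "'a :: complex_vector set \<Rightarrow> 'b :: complex_vector set \<Rightarrow>
    ('a, 'b) tensor mat \<Rightarrow> ('a, 'b) tensor mat \<Rightarrow> ('a, 'b) tensor mat" where
  "tmat_dsum V W u u' =
    four_block_mat u (tmat_zero V W (dim_row u) (dim_col u'))
      (tmat_zero V W (dim_row u') (dim_col u)) u'"

text \<open>$\alpha u \beta$ for scalar matrices $\alpha$ and $\beta$, that is,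
  $(\alpha u \beta)_{ij} = \sum_{k,l} \alpha_{ik} \beta_{lj} u_{kl}$.\<close>

definition tmat_sandwich ::
  "'a :: complex_vector set \<Rightarrow> 'b :: complex_vector set \<Rightarrow>
    complex mat \<Rightarrow> ('a, 'b) tensor mat \<Rightarrow> complex mat \<Rightarrow> ('a, 'b) tensor mat" where
  "tmat_sandwich V W \<alpha> u \<beta> =
    mat (dim_row \<alpha>) (dim_col \<beta>) (\<lambda>(i, j).
      tensor_sum V W (\<lambda>(k, l). tensor_scale V W (\<alpha> $$ (i, k) * \<beta> $$ (l, j)) (u $$ (k, l)))
        ({..<dim_row u} \<times> {..<dim_col u}))"

definition schur_product ::
  "'a :: complex_vector set \<Rightarrow> 'b :: complex_vector set \<Rightarrow>
    'a mat \<Rightarrow> 'b mat \<Rightarrow> ('a, 'b) tensor mat" where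
  "schur_product V W x y =
    mat (dim_row x) (dim_col x) (\<lambda>ij. elem_tensor V W (x $$ ij) (y $$ ij))"

definition schur_norm ::
  "('h :: chilbert_space \<Rightarrow>\<^sub>L 'h) set \<Rightarrow> ('k :: chilbert_space \<Rightarrow>\<^sub>L 'k) set \<Rightarrow>
    ('h \<Rightarrow>\<^sub>L 'h, 'k \<Rightarrow>\<^sub>L 'k) tensor mat \<Rightarrow> real" where
  "schur_norm V W u =
    Inf {cmat_norm \<alpha> * opmat_norm x * opmat_norm y * cmat_norm \<beta> | n \<alpha> x y \<beta>.
      1 \<le> n \<and> x \<in> matrices n V \<and> y \<in> matrices n W \<and>
      \<alpha> \<in> carrier_mat (dim_row u) n \<and> \<beta> \<in> carrier_mat n (dim_col u) \<and>
      u = tmat_sandwich V W \<alpha> (schur_product V W x y) \<beta>}"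

definition norm_on_tensor_matrices ::
  "'a :: complex_vector set \<Rightarrow> 'b :: complex_vector set \<Rightarrow> nat \<Rightarrow>
    (('a, 'b) tensor mat \<Rightarrow> real) \<Rightarrow> bool" where
  "norm_on_tensor_matrices V W p N \<longleftrightarrow>
    (\<forall>u\<in>matrices p (tensor_product V W).
      0 \<le> N u \<and> (N u = 0 \<longleftrightarrow> u = tmat_zero V W p p) \<and>
      (\<forall>c. N (tmat_scale V W c u) = cmod c * N u) \<and>
      (\<forall>u'\<in>matrices p (tensor_product V W). N (tmat_add V W u u') \<le> N u + N u'))"

text \<open>Matrix sizes are positive integers.\<close>

definition operator_space_matrix_norm ::
  "'a :: complex_vector set \<Rightarrow> 'b :: complex_vector set \<Rightarrow>
    (('a, 'b) tensor mat \<Rightarrow> real) \<Rightarrow> bool" where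
  "operator_space_matrix_norm V W N \<longleftrightarrow>
    (\<forall>p\<ge>1. norm_on_tensor_matrices V W p N) \<and>
    (\<forall>m\<ge>1. \<forall>n\<ge>1.
      \<forall>u\<^sub>1\<in>matrices m (tensor_product V W). \<forall>u\<^sub>2\<in>matrices n (tensor_product V W).
        N (tmat_dsum V W u\<^sub>1 u\<^sub>2) = max (N u\<^sub>1) (N u\<^sub>2)) \<and>
    (\<forall>m\<ge>1. \<forall>p\<ge>1.
      \<forall>u\<in>matrices m (tensor_product V W). \<forall>\<gamma>\<in>carrier_mat p m. \<forall>\<delta>\<in>carrier_mat m p.
        N (tmat_sandwich V W \<gamma> u \<delta>) \<le> cmat_norm \<gamma> * N u * cmat_norm \<delta>)"

end

theory Submission
  imports Defs
begin

text \<open>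
  The axioms except definiteness come from a calculus of decompositions $u = \alpha(x \circ y)\beta$.
  For every $r > \|u\|_s$ a decomposition can be rescaled so that $x$ and $y$ are contractions and
  $\|\alpha\|, \|\beta\| \le \sqrt r$ (\<open>schur_norm_less_decomposition\<close>). Two such decompositions are
  combined through $x \oplus x'$ and $y \oplus y'$, which are contractions again. If the outer factors
  are joined to a row $[\alpha\ \alpha']$ and a column, their squared norms add, and the triangle
  inequality follows (\<open>schur_decomposition_add\<close>); if they are joined to block diagonal matrices, the
  larger of their norms bounds the result, and $\|u_1 \oplus u_2\|_s \le \max\{\|u_1\|_s, \|u_2\|_s\}$ follows
  (\<open>schur_decomposition_dsum\<close>). Multiplying the outer factors by $\gamma$ and $\delta$ gives
  $\|\gamma u \delta\|_s \le \|\gamma\| \|u\|_s \|\delta\|$; homogeneity and the other inequality for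
  direct sums are special cases. The sum construction also shows that every tensor matrix has a
  decomposition, since a single elementary tensor in a single entry has one.

  For definiteness, fix vectors $\xi, \eta, \xi', \eta'$ and evaluate the entries of $u$ at the form
  $v \otimes w \mapsto \langle v\xi, \eta\rangle \langle w\xi', \eta'\rangle$. The rows of
  $[\langle x_{kl}\xi, \eta\rangle]$ and the columns of $[\langle y_{kl}\xi', \eta'\rangle]$ have
  Euclidean norms at most $\|x\| \|\xi\| \|\eta\|$ and $\|y\| \|\xi'\| \|\eta'\|$, so the
  Cauchy-Schwarz inequality bounds each evaluated entry by $\|u\|_s$ times the norms of the four
  vectors (\<open>schur_decomposition_bound\<close>). Hence all evaluations vanish if $\|u\|_s = 0$, and then
  $u = 0$, because these forms separate the points of $V \otimes W$
  (\<open>pair_sum_relation_if_forms_vanish\<close>).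

  The separation property has a second use. It identifies $V \otimes W$, a quotient of formal sums,
  with a space of complex functions of $(\xi, \eta, \xi', \eta')$, so that every identity between
  tensor matrices becomes one between finite sums of complex numbers.
\<close>

section \<open>Complex vector spaces and formal sums as modules\<close>

interpretation complex_module: Modules.module "scaleC :: complex \<Rightarrow> 'a \<Rightarrow> 'a :: complex_vector"
  by unfold_locales
    (simp_all add: scaleC_add_right scaleC_add_left scaleC_scaleC scaleR_scaleC [of 1, symmetric, simplified])

lemma lookup_formal_scale [simp]:
  "Poly_Mapping.lookup (formal_scale c f) k = c * Poly_Mapping.lookup f k"
  by (simp add: formal_scale_def Poly_Mapping.map.rep_eq when_def)

interpretation formal_module: Modules.module formal_scale
  by unfold_locales (rule poly_mapping_eqI, simp add: lookup_add algebra_simps)+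

section \<open>Inner products\<close>

lemma cinner_add_right: "cinner x (y + z) = cinner x y + cinner x (z :: 'a :: chilbert_space)"
  by (metis cinner_commute cinner_add_left complex_cnj_add)

lemma cinner_zero_left [simp]: "cinner (0 :: 'a :: chilbert_space) y = 0"
  by (metis add_cancel_left_right cinner_add_left)

lemma cinner_sum_left: "cinner (\<Sum>i\<in>I. f i) y = (\<Sum>i\<in>I. cinner (f i :: 'a :: chilbert_space) y)"
  by (induction I rule: infinite_finite_induct) (simp_all add: cinner_add_left)

lemma Re_cinner_self: "Re (cinner x x) = (norm (x :: 'a :: chilbert_space))\<^sup>2"
  by (metis norm_eq_sqrt_cinner norm_ge_zero real_sqrt_ge_0_iff real_sqrt_pow2)

lemma cinner_self_eq_0_iff: "cinner x x = 0 \<longleftrightarrow> (x :: 'a :: chilbert_space) = 0"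
  by (metis Re_cinner_self cinner_zero_left norm_eq_zero power_eq_0_iff zero_complex.sel(1))

text \<open>The triangle inequality is part of the class of Banach spaces and says
  $\|x + y\|^2 \le (\|x\| + \|y\|)^2$ here; expanding the left side leaves the inequality for the
  real part.\<close>

lemma Re_cinner_le: "Re (cinner x y) \<le> norm x * norm (y :: 'a :: chilbert_space)"
proof -
  have "Re (cinner y x) = Re (cinner x y)"
    by (metis cinner_commute cnj.sel(1))
  then have "(norm (x + y))\<^sup>2 = (norm x)\<^sup>2 + 2 * Re (cinner x y) + (norm y)\<^sup>2"
    by (simp add: Re_cinner_self [symmetric] cinner_add_left cinner_add_right)
  moreover have "(norm (x + y))\<^sup>2 \<le> (norm x + norm y)\<^sup>2"
    by (intro power_mono norm_triangle_ineq norm_ge_zero)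
  ultimately show ?thesis
    by (simp add: power2_sum)
qed

lemma cmod_cinner_le: "cmod (cinner x y) \<le> norm x * norm (y :: 'a :: chilbert_space)"
proof (cases "cinner x y = 0")
  case False
  \<comment> \<open>Rotating $x$ by a unimodular scalar makes the inner product real and nonnegative.\<close>
  define a where "a = cnj (sgn (cinner x y))"
  have "cmod a = 1"
    using False by (simp add: a_def norm_sgn)
  have "a * cinner x y = cnj (cinner x y) * cinner x y / complex_of_real (cmod (cinner x y))"
    by (simp add: a_def sgn_eq)
  also have "\<dots> = complex_of_real (cmod (cinner x y))"
    using False
    by (simp add: mult.commute [of "cnj _"] complex_norm_square [symmetric] power2_eq_square
        del: of_real_power)
  finally have "cmod (cinner x y) = Re (cinner (a *\<^sub>C x) y)"
    by (simp add: cinner_scaleC_left)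
  also have "\<dots> \<le> norm (a *\<^sub>C x) * norm y"
    by (rule Re_cinner_le)
  finally show ?thesis
    by (simp add: norm_scaleC \<open>cmod a = 1\<close>)
qed simp

lemma blinfun_eq_0_if_cinner_eq_0:
  fixes T :: "'h :: chilbert_space \<Rightarrow>\<^sub>L 'h"
  assumes "\<And>\<xi> \<eta>. cinner (T \<xi>) \<eta> = 0"
  shows "T = 0"
  using assms cinner_self_eq_0_iff by (intro blinfun_eqI) auto

section \<open>Vector functionals on formal sums\<close>

definition formal_eval :: "('x \<Rightarrow> complex) \<Rightarrow> ('x \<Rightarrow>\<^sub>0 complex) \<Rightarrow> complex" where
  "formal_eval g f = (\<Sum>k\<in>Poly_Mapping.keys f. Poly_Mapping.lookup f k * g k)"

lemma formal_eval_superset: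
  assumes "finite K" "Poly_Mapping.keys f \<subseteq> K"
  shows "formal_eval g f = (\<Sum>k\<in>K. Poly_Mapping.lookup f k * g k)"
  unfolding formal_eval_def using assms
  by (intro sum.mono_neutral_left) (auto simp: in_keys_iff)

lemma formal_eval_zero [simp]: "formal_eval g 0 = 0"
  by (simp add: formal_eval_def)

lemma formal_eval_add [simp]: "formal_eval g (f + f') = formal_eval g f + formal_eval g f'"
  using formal_eval_superset [of "Poly_Mapping.keys f \<union> Poly_Mapping.keys f'"] Poly_Mapping.keys_add [of f f']
  by (simp add: lookup_add ring_distribs sum.distrib)

lemma keys_formal_scale: "Poly_Mapping.keys (formal_scale c f) \<subseteq> Poly_Mapping.keys f"
  by (auto simp: in_keys_iff)

lemma formal_eval_scale [simp]: "formal_eval g (formal_scale c f) = c * formal_eval g f"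
  using formal_eval_superset [OF _ keys_formal_scale, of f g c] 
  by (simp add: formal_eval_def sum_distrib_left mult.assoc)

lemma formal_eval_diff [simp]: "formal_eval g (f - f') = formal_eval g f - formal_eval g f'"
  by (metis add_diff_cancel diff_add_cancel formal_eval_add)

lemma formal_eval_sum: "formal_eval g (\<Sum>i\<in>I. f i) = (\<Sum>i\<in>I. formal_eval g (f i))"
  by (induction I rule: infinite_finite_induct) simp_all

lemma formal_eval_single [simp]: "formal_eval g (Poly_Mapping.single k c) = c * g k"
  using formal_eval_superset [of "{k}" "Poly_Mapping.single k c" g] by simp

text \<open>The product of the vector functionals $v \mapsto \langle v\xi, \eta\rangle$ and
  $w \mapsto \langle w\xi', \eta'\rangle$. Such functionals separate the
  operators on each side.\<close>

definition vector_form ::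
  "'h \<times> 'h \<times> 'k \<times> 'k \<Rightarrow> ('h :: chilbert_space \<Rightarrow>\<^sub>L 'h) \<times> ('k :: chilbert_space \<Rightarrow>\<^sub>L 'k) \<Rightarrow> complex" where
  "vector_form = (\<lambda>(\<xi>, \<eta>, \<xi>', \<eta>') (v, w). cinner (v \<xi>) \<eta> * cinner (w \<xi>') \<eta>')"

lemma blinfun_apply_scaleC: "blinfun_apply (c *\<^sub>C T) x = c *\<^sub>C T x"
  by transfer simp

lemma vector_form_add_left: "vector_form q (v + v', w) = vector_form q (v, w) + vector_form q (v', w)"
  and vector_form_add_right: "vector_form q (v, w + w') = vector_form q (v, w) + vector_form q (v, w')"
  and vector_form_scale_left: "vector_form q (c *\<^sub>C v, w) = c * vector_form q (v, w)"
  and vector_form_scale_right: "vector_form q (v, c *\<^sub>C w) = c * vector_form q (v, w)"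
  by (simp_all add: vector_form_def case_prod_unfold plus_blinfun.rep_eq cinner_add_left
      cinner_scaleC_left blinfun_apply_scaleC algebra_simps)

lemma formal_eval_relation:
  assumes "f \<in> formal_module.span (bilinear_relations V W)"
  shows "formal_eval (vector_form q) f = 0"
  using assms
proof (induction rule: formal_module.span_induct_alt)
  case (step c x y)
  then show ?case
    by (auto simp: bilinear_relations_def vector_form_add_left vector_form_add_right
        vector_form_scale_left vector_form_scale_right)
qed simp

section \<open>The vector functionals separate the tensor product\<close>

definition pair_sum :: "('a \<times> 'b) list \<Rightarrow> 'a \<times> 'b \<Rightarrow>\<^sub>0 complex" where
  "pair_sum ps = (\<Sum>p\<leftarrow>ps. Poly_Mapping.single p 1)"

lemma pair_sum_simps [simp]:
  "pair_sum [] = 0"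
  "pair_sum (p # ps) = Poly_Mapping.single p 1 + pair_sum ps"
  by (simp_all add: pair_sum_def)

abbreviation relation_span ::
  "'a :: complex_vector set \<Rightarrow> 'b :: complex_vector set \<Rightarrow> ('a \<times> 'b \<Rightarrow>\<^sub>0 complex) set" where
  "relation_span V W \<equiv> formal_module.span (bilinear_relations V W)"

lemma relation_add_left:
  "\<lbrakk>v \<in> V; v' \<in> V; w \<in> W\<rbrakk> \<Longrightarrow> formal_pair (v + v') w - formal_pair v w - formal_pair v' w \<in> relation_span V W"
  and relation_add_right:
  "\<lbrakk>v \<in> V; w \<in> W; w' \<in> W\<rbrakk> \<Longrightarrow> formal_pair v (w + w') - formal_pair v w - formal_pair v w' \<in> relation_span V W"
  and relation_scale_left:
  "\<lbrakk>v \<in> V; w \<in> W\<rbrakk> \<Longrightarrow> formal_pair (c *\<^sub>C v) w - formal_scale c (formal_pair v w) \<in> relation_span V W"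
  and relation_scale_right:
  "\<lbrakk>v \<in> V; w \<in> W\<rbrakk> \<Longrightarrow> formal_pair v (c *\<^sub>C w) - formal_scale c (formal_pair v w) \<in> relation_span V W"
  by (rule formal_module.span_base; unfold bilinear_relations_def; blast)+

lemma relation_zero_left: "\<lbrakk>v \<in> V; w \<in> W\<rbrakk> \<Longrightarrow> formal_pair 0 w \<in> relation_span V W"
  using relation_scale_left [of v V w W 0] by simp

lemma relation_zero_right: "\<lbrakk>v \<in> V; w \<in> W\<rbrakk> \<Longrightarrow> formal_pair v 0 \<in> relation_span V W"
  using relation_scale_right [of v V w W 0] by simp

text \<open>The coefficient of a pair can be moved into its first component, so modulo the bilinearity
  relations every formal sum is a sum of pairs with coefficient $1$. This is the form in which the
  number of summands can be reduced below.\<close>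

lemma formal_sum_cong_pair_sum:
  assumes V: "complex_module.subspace V" and f: "f \<in> formal_sums V W"
  obtains ps where "set ps \<subseteq> V \<times> W" "f - pair_sum ps \<in> relation_span V W"
proof -
  have "finite K \<Longrightarrow> K \<subseteq> V \<times> W \<Longrightarrow> \<exists>ps. set ps \<subseteq> V \<times> W \<and>
      (\<Sum>k\<in>K. Poly_Mapping.single k (Poly_Mapping.lookup f k)) - pair_sum ps \<in> relation_span V W" for K
  proof (induction K rule: finite_induct)
    case empty
    then show ?case
      by (intro exI [of _ "[]"]) (simp add: formal_module.span_zero)
  next
    case (insert k K)
    obtain v w where k: "k = (v, w)"
      by fastforce
    define c where "c = Poly_Mapping.lookup f k"
    obtain ps where ps: "set ps \<subseteq> V \<times> W"
      "(\<Sum>k\<in>K. Poly_Mapping.single k (Poly_Mapping.lookup f k)) - pair_sum ps \<in> relation_span V W" (is "?S - _ \<in> _")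
      using insert by auto
    have vw: "v \<in> V" "w \<in> W"
      using insert.prems k by auto
    have "formal_scale c (formal_pair v w) = Poly_Mapping.single k c"
      by (rule poly_mapping_eqI) (simp add: k lookup_single when_def)
    then have "Poly_Mapping.single k c + ?S - pair_sum ((c *\<^sub>C v, w) # ps)
        = (?S - pair_sum ps) - (formal_pair (c *\<^sub>C v) w - formal_scale c (formal_pair v w))"
      by simp
    also have "\<dots> \<in> relation_span V W"
      by (intro formal_module.span_diff ps relation_scale_left vw)
    finally show ?case
      using insert.hyps ps(1) vw complex_module.subspace_scale [OF V, of v c]
      by (intro exI [of _ "(c *\<^sub>C v, w) # ps"]) (simp add: c_def del: pair_sum_simps)
  qed
  moreover have "f = (\<Sum>k\<in>Poly_Mapping.keys f. Poly_Mapping.single k (Poly_Mapping.lookup f k))"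
    by (rule poly_mapping_eqI) (simp add: lookup_sum lookup_single when_def in_keys_iff)
  moreover have "Poly_Mapping.keys f \<subseteq> V \<times> W"
    using f by (simp add: formal_sums_def)
  ultimately obtain ps where "set ps \<subseteq> V \<times> W" "f - pair_sum ps \<in> relation_span V W"
    using finite_keys by metis
  then show thesis
    by (rule that)
qed

text \<open>Modulo the bilinearity relations,
  $\sum_i v_i \otimes w_i = \sum_i (v_i - c_i v_0) \otimes w_i + v_0 \otimes \sum_i c_i w_i$.
  The scalar $c_i$ may depend on $v_i$ alone because in the application it is a functional of
  $v_i$.\<close>

lemma pair_sum_shear:
  assumes V: "complex_module.subspace V" and W: "complex_module.subspace W"
    and v0: "v0 \<in> V" and ps: "set ps \<subseteq> V \<times> W"
  shows "pair_sum (map (\<lambda>(v, w). (v - c v *\<^sub>C v0, w)) ps) - pair_sum ps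
      + formal_pair v0 (\<Sum>(v, w)\<leftarrow>ps. c v *\<^sub>C w) \<in> relation_span V W
    \<and> (\<Sum>(v, w)\<leftarrow>ps. c v *\<^sub>C w) \<in> W"
  using ps
proof (induction ps)
  case Nil
  then show ?case
    using relation_zero_right [OF v0, of 0 W] complex_module.subspace_0 [OF W] by simp
next
  case (Cons p ps)
  obtain v w where p: "p = (v, w)"
    by fastforce
  have vw: "v \<in> V" "w \<in> W"
    using Cons.prems p by auto
  define s where "s = (\<Sum>(v, w)\<leftarrow>ps. c v *\<^sub>C w)"
  let ?d = "pair_sum (map (\<lambda>(v, w). (v - c v *\<^sub>C v0, w)) ps) - pair_sum ps"
  have IH: "?d + formal_pair v0 s \<in> relation_span V W" "s \<in> W"
    using Cons by (simp_all add: s_def)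
  have cv: "c v *\<^sub>C v0 \<in> V" "v - c v *\<^sub>C v0 \<in> V" "c v *\<^sub>C w \<in> W" "c v *\<^sub>C w + s \<in> W"
    using V W vw v0 IH by (auto intro: complex_module.subspace_scale complex_module.subspace_diff
        complex_module.subspace_add)
  \<comment> \<open>The new summand contributes four instances of the bilinearity relations.\<close>
  have "formal_pair (v - c v *\<^sub>C v0) w + ?d - formal_pair v w + formal_pair v0 (c v *\<^sub>C w + s)
      = (?d + formal_pair v0 s)
      - (formal_pair (v - c v *\<^sub>C v0 + c v *\<^sub>C v0) w - formal_pair (v - c v *\<^sub>C v0) w - formal_pair (c v *\<^sub>C v0) w)
      - (formal_pair (c v *\<^sub>C v0) w - formal_scale (c v) (formal_pair v0 w))
      + (formal_pair v0 (c v *\<^sub>C w) - formal_scale (c v) (formal_pair v0 w))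
      + (formal_pair v0 (c v *\<^sub>C w + s) - formal_pair v0 (c v *\<^sub>C w) - formal_pair v0 s)"
    by simp
  also have "\<dots> \<in> relation_span V W"
    by (intro formal_module.span_add formal_module.span_diff IH relation_add_left relation_add_right
        relation_scale_left relation_scale_right vw v0 cv)
  finally show ?case
    using cv by (simp add: p s_def algebra_simps)
qed

text \<open>Induction on the number of summands. Suppose that all vector functionals vanish on
  $v_0 \otimes w_0 + \sum_i v_i \otimes w_i$. If $v_0 = 0$, the first summand is dropped. Otherwise
  $\varphi(v_0) \ne 0$ for some vector functional $\varphi$, and since the functionals on the second
  factor separate operators, $\varphi(v_0) w_0 + \sum_i \varphi(v_i) w_i = 0$. Substituting this for
  $w_0$ turns the tensor into
  $\sum_i (v_i - (\varphi(v_i) / \varphi(v_0)) v_0) \otimes w_i$, which has one summand less.\<close>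

lemma pair_sum_relation_if_forms_vanish:
  fixes V :: "('h :: chilbert_space \<Rightarrow>\<^sub>L 'h) set" and W :: "('k :: chilbert_space \<Rightarrow>\<^sub>L 'k) set"
  assumes V: "complex_module.subspace V" and W: "complex_module.subspace W"
    and ps: "set ps \<subseteq> V \<times> W"
    and vanish: "\<And>q. formal_eval (vector_form q) (pair_sum ps) = 0"
  shows "pair_sum ps \<in> relation_span V W"
  using ps vanish
proof (induction "length ps" arbitrary: ps)
  case 0
  then show ?case
    by (simp add: formal_module.span_zero)
next
  case (Suc n)
  obtain v0 w0 ps' where ps: "ps = (v0, w0) # ps'"
    using Suc.hyps(2) by (metis length_Suc_conv surj_pair)
  have v0: "v0 \<in> V" and w0: "w0 \<in> W" and ps': "set ps' \<subseteq> V \<times> W"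
    using Suc.prems(1) ps by auto
  show ?case
  proof (cases "v0 = 0")
    case True
    have rel: "formal_pair v0 w0 \<in> relation_span V W"
      using relation_zero_left [OF v0 w0] True by simp
    have "pair_sum ps' \<in> relation_span V W"
    proof (rule Suc.hyps(1))
      fix q
      show "formal_eval (vector_form q) (pair_sum ps') = 0"
        using Suc.prems(2) [of q] formal_eval_relation [OF rel, of q] by (simp add: ps)
    qed (use Suc.hyps(2) ps ps' in auto)
    then show ?thesis
      using rel by (simp add: ps formal_module.span_add)
  next
    case False
    then obtain \<xi> \<eta> where a: "cinner (v0 \<xi>) \<eta> \<noteq> 0"
      using blinfun_eq_0_if_cinner_eq_0 by metis
    define c where "c = (\<lambda>v. cinner (blinfun_apply v \<xi>) \<eta> / cinner (v0 \<xi>) \<eta>)"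
    define s where "s = (\<Sum>(v, w)\<leftarrow>ps'. c v *\<^sub>C w)"
    let ?ps'' = "map (\<lambda>(v, w). (v - c v *\<^sub>C v0, w)) ps'"
    have rel: "pair_sum ?ps'' - pair_sum ps' + formal_pair v0 s \<in> relation_span V W" and s: "s \<in> W"
      using pair_sum_shear [OF V W v0 ps', of c] unfolding s_def by blast+
    have "w0 + s = 0"
    proof (rule blinfun_eq_0_if_cinner_eq_0)
      fix \<xi>' \<eta>' :: 'k
      let ?q = "(\<xi>, \<eta>, \<xi>', \<eta>')"
      have "formal_eval (vector_form ?q) (pair_sum ps')
          = cinner (v0 \<xi>) \<eta> * cinner (blinfun_apply (\<Sum>(v, w)\<leftarrow>ps'. c v *\<^sub>C w) \<xi>') \<eta>'"
      proof (induction ps')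
        case (Cons p ps')
        then show ?case
          using a by (cases p) (simp add: vector_form_def c_def blinfun.add_left cinner_add_left
              blinfun_apply_scaleC cinner_scaleC_left algebra_simps)
      qed simp
      then have "cinner (v0 \<xi>) \<eta> * cinner (blinfun_apply (w0 + s) \<xi>') \<eta>' = 0"
        using Suc.prems(2) [of ?q]
        by (simp add: ps vector_form_def s_def blinfun.add_left cinner_add_left algebra_simps)
      then show "cinner (blinfun_apply (w0 + s) \<xi>') \<eta>' = 0"
        using a by simp
    qed
    have "pair_sum ps - pair_sum ?ps'' = formal_pair v0 (w0 + s)
        - (formal_pair v0 (w0 + s) - formal_pair v0 w0 - formal_pair v0 s)
        - (pair_sum ?ps'' - pair_sum ps' + formal_pair v0 s)"
      by (simp add: ps)
    also have "\<dots> \<in> relation_span V W"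
      using relation_zero_right [OF v0 w0] \<open>w0 + s = 0\<close>
      by (intro formal_module.span_diff rel relation_add_right v0 w0 s) simp
    finally have diff: "pair_sum ps - pair_sum ?ps'' \<in> relation_span V W" .
    have "pair_sum ?ps'' \<in> relation_span V W"
    proof (rule Suc.hyps(1))
      show "set ?ps'' \<subseteq> V \<times> W"
        using ps' v0 V by (auto intro!: complex_module.subspace_diff complex_module.subspace_scale)
      fix q
      show "formal_eval (vector_form q) (pair_sum ?ps'') = 0"
        using formal_eval_relation [OF diff, of q] Suc.prems(2) [of q] by simp
    qed (use Suc.hyps(2) ps in auto)
    then show ?thesis
      using formal_module.span_add [OF diff] by fastforce
  qed
qed

text \<open>The quotient that defines the tensor product is therefore the quotient by the common kernel
  of the vector functionals. All later identities between tensors are checked by evaluation.\<close>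

lemma tensor_rel_iff_forms_agree:
  fixes V :: "('h :: chilbert_space \<Rightarrow>\<^sub>L 'h) set" and W :: "('k :: chilbert_space \<Rightarrow>\<^sub>L 'k) set"
  assumes V: "complex_module.subspace V" and W: "complex_module.subspace W"
  shows "(f, g) \<in> tensor_rel V W \<longleftrightarrow> f \<in> formal_sums V W \<and> g \<in> formal_sums V W \<and>
    (\<forall>q. formal_eval (vector_form q) f = formal_eval (vector_form q) g)"
proof -
  have "f - g \<in> relation_span V W"
    if f: "f \<in> formal_sums V W" and g: "g \<in> formal_sums V W"
      and eq: "\<And>q. formal_eval (vector_form q) f = formal_eval (vector_form q) g"
  proof -
    have "Poly_Mapping.keys (f - g) \<subseteq> V \<times> W"
      using f g keys_diff [of f g] unfolding formal_sums_def by blast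
    then have "f - g \<in> formal_sums V W"
      by (simp add: formal_sums_def)
    then obtain ps where ps: "set ps \<subseteq> V \<times> W" "(f - g) - pair_sum ps \<in> relation_span V W"
      using formal_sum_cong_pair_sum [OF V] by blast
    have "formal_eval (vector_form q) (pair_sum ps) = 0" for q
      using formal_eval_relation [OF ps(2), of q] eq [of q] by simp
    then have "pair_sum ps \<in> relation_span V W"
      by (rule pair_sum_relation_if_forms_vanish [OF V W ps(1)])
    then show ?thesis
      using formal_module.span_add [OF ps(2)] by fastforce
  qed
  moreover have "formal_eval (vector_form q) f = formal_eval (vector_form q) g" if "f - g \<in> relation_span V W" for q
    using formal_eval_relation [OF that, of q] by simp
  ultimately show ?thesis
    unfolding tensor_rel_def by auto
qed

section \<open>Tensors as functions of four vectors\<close>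

lemma formal_sums_zero: "0 \<in> formal_sums V W"
  by (simp add: formal_sums_def)

lemma formal_sums_add: "\<lbrakk>f \<in> formal_sums V W; g \<in> formal_sums V W\<rbrakk> \<Longrightarrow> f + g \<in> formal_sums V W"
  using Poly_Mapping.keys_add [of f g] by (auto simp: formal_sums_def)

lemma formal_sums_scale: "f \<in> formal_sums V W \<Longrightarrow> formal_scale c f \<in> formal_sums V W"
  using keys_formal_scale [of c f] by (auto simp: formal_sums_def)

lemma formal_sums_sum: "(\<And>i. i \<in> I \<Longrightarrow> f i \<in> formal_sums V W) \<Longrightarrow> (\<Sum>i\<in>I. f i) \<in> formal_sums V W"
  by (induction I rule: infinite_finite_induct) (simp_all add: formal_sums_zero formal_sums_add)

text \<open>The functionals are constant on a tensor, that is, on an equivalence class of formal sums,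
  so any representative serves.\<close>

definition tensor_eval ::
  "'h \<times> 'h \<times> 'k \<times> 'k \<Rightarrow> ('h :: chilbert_space \<Rightarrow>\<^sub>L 'h, 'k :: chilbert_space \<Rightarrow>\<^sub>L 'k) tensor \<Rightarrow> complex" where
  "tensor_eval q t = formal_eval (vector_form q) (SOME f. f \<in> t)"

locale tensor_of_subspaces =
  fixes V :: "('h :: chilbert_space \<Rightarrow>\<^sub>L 'h) set" and W :: "('k :: chilbert_space \<Rightarrow>\<^sub>L 'k) set"
  assumes V: "complex_module.subspace V" and W: "complex_module.subspace W"
begin

lemma mem_tensor:
  assumes "t \<in> tensor_product V W" "f \<in> t"
  shows "f \<in> formal_sums V W" "formal_eval (vector_form q) f = tensor_eval q t"
proof -
  obtain g where t: "t = tensor_rel V W `` {g}"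
    using assms(1) unfolding tensor_product_def by (elim quotientE)
  have f: "f \<in> formal_sums V W" "\<And>h. h \<in> t \<longleftrightarrow> h \<in> formal_sums V W \<and>
      (\<forall>q. formal_eval (vector_form q) h = formal_eval (vector_form q) f)"
    using assms(2) by (auto simp: t tensor_rel_iff_forms_agree [OF V W])
  then show "f \<in> formal_sums V W"
    by simp
  have "(SOME f. f \<in> t) \<in> t"
    using assms(2) by (rule someI)
  then show "formal_eval (vector_form q) f = tensor_eval q t"
    using f(2) unfolding tensor_eval_def by metis
qed

lemma tensor_nonempty: "t \<in> tensor_product V W \<Longrightarrow> \<exists>f. f \<in> t"
  unfolding tensor_product_def by (auto elim!: quotientE simp: tensor_rel_iff_forms_agree [OF V W])

lemma tensor_class:
  assumes "f \<in> formal_sums V W"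
  shows "tensor_rel V W `` {f} \<in> tensor_product V W"
    and "tensor_eval q (tensor_rel V W `` {f}) = formal_eval (vector_form q) f"
proof -
  show t: "tensor_rel V W `` {f} \<in> tensor_product V W"
    using assms by (simp add: tensor_product_def quotientI)
  show "tensor_eval q (tensor_rel V W `` {f}) = formal_eval (vector_form q) f"
    using assms mem_tensor(2) [OF t, of f] by (simp add: tensor_rel_iff_forms_agree [OF V W])
qed

lemma tensor_eqI:
  assumes "s \<in> tensor_product V W" "t \<in> tensor_product V W"
    and "\<And>q. tensor_eval q s = tensor_eval q t"
  shows "s = t"
proof -
  obtain f g where fg: "s = tensor_rel V W `` {f}" "f \<in> formal_sums V W"
    "t = tensor_rel V W `` {g}" "g \<in> formal_sums V W"
    using assms(1,2) unfolding tensor_product_def by (elim quotientE) blast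
  then have "formal_eval (vector_form q) f = formal_eval (vector_form q) g" for q
    using assms(3) tensor_class(2) by metis
  then show ?thesis
    using fg by (auto simp: tensor_rel_iff_forms_agree [OF V W])
qed

text \<open>Each operation on classes is a union of the classes of a set of formal sums. If the
  functionals take the same values on all of these sums, the union is a single class with these
  values.\<close>

lemma tensor_Union_classes:
  assumes "S \<noteq> {}" and "\<And>f. f \<in> S \<Longrightarrow> f \<in> formal_sums V W"
    and "\<And>f q. f \<in> S \<Longrightarrow> formal_eval (vector_form q) f = e q"
  shows "(\<Union>f\<in>S. tensor_rel V W `` {f}) \<in> tensor_product V W"
    and "tensor_eval q (\<Union>f\<in>S. tensor_rel V W `` {f}) = e q"
proof -
  obtain f where f: "f \<in> S"
    using assms(1) by blast
  have "tensor_rel V W `` {g} = tensor_rel V W `` {f}" if "g \<in> S" for g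
    using f that assms(2,3) by (intro tensor_eqI) (simp_all add: tensor_class)
  then have "(\<Union>g\<in>S. tensor_rel V W `` {g}) = tensor_rel V W `` {f}"
    using f by blast
  then show "(\<Union>f\<in>S. tensor_rel V W `` {f}) \<in> tensor_product V W"
    "tensor_eval q (\<Union>f\<in>S. tensor_rel V W `` {f}) = e q"
    using assms(2,3) f by (simp_all add: tensor_class)
qed

lemma elem_tensor:
  assumes "v \<in> V" "w \<in> W"
  shows "elem_tensor V W v w \<in> tensor_product V W"
    and "tensor_eval q (elem_tensor V W v w) = vector_form q (v, w)"
proof -
  have "formal_pair v w \<in> formal_sums V W"
    using assms by (simp add: formal_sums_def)
  then show "elem_tensor V W v w \<in> tensor_product V W"
    "tensor_eval q (elem_tensor V W v w) = vector_form q (v, w)"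
    by (simp_all add: elem_tensor_def tensor_class)
qed

lemma tensor_zero:
  "tensor_zero V W \<in> tensor_product V W" "tensor_eval q (tensor_zero V W) = 0"
  by (simp_all add: tensor_zero_def tensor_class formal_sums_zero)

lemma tensor_add:
  assumes "s \<in> tensor_product V W" "t \<in> tensor_product V W"
  shows "tensor_add V W s t \<in> tensor_product V W"
    and "tensor_eval q (tensor_add V W s t) = tensor_eval q s + tensor_eval q t"
proof -
  let ?S = "(\<lambda>(f, g). f + g) ` (s \<times> t)"
  have eq: "tensor_add V W s t = (\<Union>f\<in>?S. tensor_rel V W `` {f})"
    by (auto simp: tensor_add_def)
  have ne: "?S \<noteq> {}"
    using assms tensor_nonempty by blast
  have mem: "f \<in> formal_sums V W" if "f \<in> ?S" for f
    using that mem_tensor(1) [OF assms(1)] mem_tensor(1) [OF assms(2)] by (auto intro: formal_sums_add)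
  have val: "formal_eval (vector_form q) f = tensor_eval q s + tensor_eval q t" if "f \<in> ?S" for f q
    using that mem_tensor(2) [OF assms(1), of _ q] mem_tensor(2) [OF assms(2), of _ q] by auto
  show "tensor_add V W s t \<in> tensor_product V W"
    unfolding eq by (rule tensor_Union_classes(1) [OF ne mem val])
  show "tensor_eval q (tensor_add V W s t) = tensor_eval q s + tensor_eval q t"
    unfolding eq by (rule tensor_Union_classes(2) [OF ne mem val])
qed

lemma tensor_scale:
  assumes "t \<in> tensor_product V W"
  shows "tensor_scale V W c t \<in> tensor_product V W"
    and "tensor_eval q (tensor_scale V W c t) = c * tensor_eval q t"
proof -
  let ?S = "formal_scale c ` t"
  have eq: "tensor_scale V W c t = (\<Union>f\<in>?S. tensor_rel V W `` {f})"
    by (auto simp: tensor_scale_def)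
  have ne: "?S \<noteq> {}"
    using assms tensor_nonempty by blast
  have mem: "f \<in> formal_sums V W" if "f \<in> ?S" for f
    using that mem_tensor(1) [OF assms] by (auto intro: formal_sums_scale)
  have val: "formal_eval (vector_form q) f = c * tensor_eval q t" if "f \<in> ?S" for f q
    using that mem_tensor(2) [OF assms, of _ q] by auto
  show "tensor_scale V W c t \<in> tensor_product V W"
    unfolding eq by (rule tensor_Union_classes(1) [OF ne mem val])
  show "tensor_eval q (tensor_scale V W c t) = c * tensor_eval q t"
    unfolding eq by (rule tensor_Union_classes(2) [OF ne mem val])
qed

lemma tensor_sum:
  assumes "\<And>i. i \<in> I \<Longrightarrow> t i \<in> tensor_product V W"
  shows "tensor_sum V W t I \<in> tensor_product V W"
    and "tensor_eval q (tensor_sum V W t I) = (\<Sum>i\<in>I. tensor_eval q (t i))"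
proof -
  let ?S = "(\<lambda>f. \<Sum>i\<in>I. f i) ` Pi I t"
  have eq: "tensor_sum V W t I = (\<Union>f\<in>?S. tensor_rel V W `` {f})"
    by (auto simp: tensor_sum_def)
  have "(\<lambda>i. SOME f. f \<in> t i) \<in> Pi I t"
    using assms tensor_nonempty by (auto intro: someI_ex)
  then have ne: "?S \<noteq> {}"
    by blast
  have mem: "g \<in> formal_sums V W" if "g \<in> ?S" for g
    using that mem_tensor(1) [OF assms] by (fastforce intro!: formal_sums_sum simp: Pi_iff)
  have val: "formal_eval (vector_form q) g = (\<Sum>i\<in>I. tensor_eval q (t i))" if "g \<in> ?S" for g q
    using that mem_tensor(2) [OF assms, of _ _ q]
    by (fastforce simp: formal_eval_sum Pi_iff intro!: sum.cong)
  show "tensor_sum V W t I \<in> tensor_product V W"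
    unfolding eq by (rule tensor_Union_classes(1) [OF ne mem val])
  show "tensor_eval q (tensor_sum V W t I) = (\<Sum>i\<in>I. tensor_eval q (t i))"
    unfolding eq by (rule tensor_Union_classes(2) [OF ne mem val])
qed

lemma tensor_eq_sum_elem_tensors:
  assumes "t \<in> tensor_product V W"
  obtains ps where "set ps \<subseteq> V \<times> W" "\<And>q. tensor_eval q t = (\<Sum>p\<leftarrow>ps. vector_form q p)"
proof -
  obtain f where f: "f \<in> t"
    using assms tensor_nonempty by blast
  obtain ps where ps: "set ps \<subseteq> V \<times> W" "f - pair_sum ps \<in> relation_span V W"
    using formal_sum_cong_pair_sum [OF V mem_tensor(1) [OF assms f]] by blast
  have "formal_eval g (pair_sum ps) = (\<Sum>p\<leftarrow>ps. g p)" for g :: "_ \<Rightarrow> complex"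
    by (induction ps) simp_all
  then have "tensor_eval q t = (\<Sum>p\<leftarrow>ps. vector_form q p)" for q
    using formal_eval_relation [OF ps(2), of q] mem_tensor(2) [OF assms f, of q] by simp
  with ps(1) that show thesis
    by blast
qed

end

section \<open>Euclidean norms and operator norms of matrices\<close>

definition l2 :: "nat \<Rightarrow> (nat \<Rightarrow> 'a :: real_normed_vector) \<Rightarrow> real" where
  "l2 n f = L2_set (\<lambda>i. norm (f i)) {..<n}"

lemma l2_nonneg [simp]: "0 \<le> l2 n f"
  by (simp add: l2_def)

lemma l2_cong: "(\<And>i. i < n \<Longrightarrow> f i = g i) \<Longrightarrow> l2 n f = l2 n g"
  unfolding l2_def by (intro L2_set_cong) auto

lemma l2_power2: "(l2 n f)\<^sup>2 = (\<Sum>i<n. (norm (f i))\<^sup>2)"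
  by (simp add: l2_def L2_set_def sum_nonneg)

lemma l2_zero [simp]: "l2 n (\<lambda>_. 0) = 0"
  by (simp add: l2_def L2_set_def)

lemma l2_scale: "0 \<le> r \<Longrightarrow> (\<And>i. i < n \<Longrightarrow> norm (f i) \<le> r * norm (g i)) \<Longrightarrow> l2 n f \<le> r * l2 n g"
  unfolding l2_def L2_set_right_distrib by (intro L2_set_mono) auto

lemma l2_scaleR: "l2 n (\<lambda>i. r *\<^sub>R f i) = \<bar>r\<bar> * l2 n f"
  by (simp add: l2_def L2_set_right_distrib)

lemma norm_le_l2: "i < n \<Longrightarrow> norm (f i) \<le> l2 n f"
  unfolding l2_def by (intro member_le_L2_set) auto

lemma l2_triangle: "l2 n (\<lambda>i. f i + g i) \<le> l2 n f + l2 n g"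
  unfolding l2_def
  by (rule order_trans [OF L2_set_mono L2_set_triangle_ineq]) (auto intro: norm_triangle_ineq)

lemma sum_lessThan_append:
  fixes n m :: nat
  shows
  "(\<Sum>k<n + m. f k) = (\<Sum>k<n. f k) + (\<Sum>k<m. f (n + k) :: 'a :: comm_monoid_add)"
  by (induction m) (simp_all add: add.assoc)

lemma l2_append: "l2 (n + m) f = sqrt ((l2 n f)\<^sup>2 + (l2 m (\<lambda>i. f (n + i)))\<^sup>2)"
  by (simp add: l2_power2 sum_lessThan_append) (simp add: l2_def L2_set_def sum_lessThan_append)

lemma l2_append_le:
  assumes "l2 n f \<le> a * b" "l2 m (\<lambda>i. f (n + i)) \<le> a * c" "0 \<le> a"
  shows "l2 (n + m) f \<le> a * sqrt (b\<^sup>2 + c\<^sup>2)"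
proof -
  have "(l2 n f)\<^sup>2 + (l2 m (\<lambda>i. f (n + i)))\<^sup>2 \<le> (a * b)\<^sup>2 + (a * c)\<^sup>2"
    using assms by (intro add_mono power_mono) simp_all
  also have "\<dots> = a\<^sup>2 * (b\<^sup>2 + c\<^sup>2)"
    by (simp add: algebra_simps power_mult_distrib)
  finally have "l2 (n + m) f \<le> sqrt (a\<^sup>2 * (b\<^sup>2 + c\<^sup>2))"
    by (simp add: l2_append)
  then show ?thesis
    using assms(3) by (simp add: real_sqrt_mult)
qed

lemma l2_segment_le:
  assumes "s + m \<le> n"
  shows "l2 m (\<lambda>i. f (s + i)) \<le> l2 n f"
proof -
  obtain r where n: "n = s + m + r"
    using assms le_Suc_ex by blast
  have "(l2 m (\<lambda>i. f (s + i)))\<^sup>2 \<le> (l2 n f)\<^sup>2"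
    by (simp add: n l2_power2 sum_lessThan_append sum_nonneg)
  then show ?thesis
    by (rule power2_le_imp_le) simp
qed

text \<open>$a$ bounds the operator norm of the $p \times n$ matrix $M$. The entries are maps, so that
  one notion covers scalar matrices, whose entries act by multiplication, and matrices of operators.
  Upper bounds are easier to propagate than the suprema that define the norms.\<close>

definition l2_bound ::
  "nat \<Rightarrow> nat \<Rightarrow> (nat \<Rightarrow> nat \<Rightarrow> 'a :: real_normed_vector \<Rightarrow> 'b :: real_normed_vector) \<Rightarrow> real \<Rightarrow> bool" where
  "l2_bound p n M a \<longleftrightarrow> 0 \<le> a \<and> (\<forall>\<xi>. l2 p (\<lambda>i. \<Sum>k<n. M i k (\<xi> k)) \<le> a * l2 n \<xi>)"

lemma l2_boundD: "l2_bound p n M a \<Longrightarrow> l2 p (\<lambda>i. \<Sum>k<n. M i k (\<xi> k)) \<le> a * l2 n \<xi>"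
  and l2_bound_nonneg: "l2_bound p n M a \<Longrightarrow> 0 \<le> a"
  by (simp_all add: l2_bound_def)

lemma l2_bound_mono: "l2_bound p n M a \<Longrightarrow> a \<le> b \<Longrightarrow> l2_bound p n M b"
  unfolding l2_bound_def by (meson l2_nonneg mult_right_mono order_trans)

lemma l2_bound_cong:
  assumes "\<And>i k. i < p \<Longrightarrow> k < n \<Longrightarrow> M i k = M' i k"
  shows "l2_bound p n M a \<longleftrightarrow> l2_bound p n M' a"
proof -
  have "l2 p (\<lambda>i. \<Sum>k<n. M i k (\<xi> k)) = l2 p (\<lambda>i. \<Sum>k<n. M' i k (\<xi> k))" for \<xi>
    using assms by (intro l2_cong sum.cong) auto
  then show ?thesis
    by (simp add: l2_bound_def)
qed

lemma hnorm_vec: "hnorm (vec p f) = l2 p f"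
  unfolding hnorm_def l2_def by (auto intro: L2_set_cong)

lemma hnorm_eq_l2: "\<xi> \<in> carrier_vec n \<Longrightarrow> hnorm \<xi> = l2 n (\<lambda>i. \<xi> $ i)"
  by (simp add: hnorm_def l2_def)

text \<open>The supremum over the unit ball is the least bound; the sum of the norms of all entries
  shows that the supremum is finite.\<close>

lemma operator_norm_l2_bound:
  fixes M :: "nat \<Rightarrow> nat \<Rightarrow> 'a :: real_normed_vector \<Rightarrow> 'b :: real_normed_vector"
    and p n :: nat
  assumes lin: "\<And>i k. bounded_linear (M i k)"
  defines "N \<equiv> SUP \<xi>\<in>{\<xi> \<in> carrier_vec n. hnorm \<xi> \<le> 1}. hnorm (vec p (\<lambda>i. \<Sum>k<n. M i k (\<xi> $ k)))"
  shows "l2_bound p n M N" and "l2_bound p n M a \<Longrightarrow> N \<le> a"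
proof -
  let ?B = "{\<xi> :: 'a vec. \<xi> \<in> carrier_vec n \<and> hnorm \<xi> \<le> 1}"
  let ?F = "\<lambda>\<xi>. hnorm (vec p (\<lambda>i. \<Sum>k<n. M i k (\<xi> $ k)))"
  have zero: "vec n (\<lambda>_. 0) \<in> ?B"
    by (simp add: hnorm_vec)
  have bdd: "bdd_above (?F ` ?B)"
  proof (rule bdd_aboveI2)
    fix \<xi> :: "'a vec"
    assume \<xi>: "\<xi> \<in> ?B"
    have "?F \<xi> \<le> (\<Sum>i<p. norm (\<Sum>k<n. M i k (\<xi> $ k)))"
      unfolding hnorm_vec l2_def by (rule L2_set_le_sum) simp
    also have "\<dots> \<le> (\<Sum>i<p. \<Sum>k<n. onorm (M i k))"
    proof (intro sum_mono order_trans [OF norm_sum])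
      fix i k
      assume k: "k \<in> {..<n}"
      have "norm (M i k (\<xi> $ k)) \<le> onorm (M i k) * norm (\<xi> $ k)"
        by (rule onorm [OF lin])
      also have "\<dots> \<le> onorm (M i k)"
        using \<xi> k norm_le_l2 [of k n "\<lambda>k. \<xi> $ k"] hnorm_eq_l2 [of \<xi> n]
        by (intro mult_left_le onorm_pos_le lin) auto
      finally show "norm (M i k (\<xi> $ k)) \<le> onorm (M i k)" .
    qed
    finally show "?F \<xi> \<le> (\<Sum>i<p. \<Sum>k<n. onorm (M i k))" .
  qed
  have upper: "?F \<xi> \<le> N" if "\<xi> \<in> ?B" for \<xi>
    unfolding N_def by (rule cSUP_upper [OF that bdd])
  have "0 \<le> N"
    by (rule order_trans [OF _ upper [OF zero]]) (simp add: hnorm_vec)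
  moreover have "l2 p (\<lambda>i. \<Sum>k<n. M i k (\<xi> k)) \<le> N * l2 n \<xi>" for \<xi>
  proof (cases "l2 n \<xi> = 0")
    case True
    then have "\<xi> k = 0" if "k < n" for k
      using norm_le_l2 [OF that, of \<xi>] by simp
    then have "(\<Sum>k<n. M i k (\<xi> k)) = 0" for i
      using linear_simps(3) [OF lin] by (intro sum.neutral) simp
    then show ?thesis
      by (simp add: True)
  next
    case False
    define r where "r = l2 n \<xi>"
    have r: "0 < r"
      using False l2_nonneg [of n \<xi>] unfolding r_def by linarith
    let ?\<zeta> = "vec n (\<lambda>k. inverse r *\<^sub>R \<xi> k)"
    have "?\<zeta> \<in> ?B"
      using r by (simp add: hnorm_vec l2_scaleR r_def [symmetric])
    then have "?F ?\<zeta> \<le> N"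
      by (rule upper)
    moreover have "(\<Sum>k<n. M i k (?\<zeta> $ k)) = inverse r *\<^sub>R (\<Sum>k<n. M i k (\<xi> k))" for i
      unfolding scaleR_sum_right by (intro sum.cong) (simp_all add: linear_simps(5) [OF lin])
    then have "?F ?\<zeta> = inverse r * l2 p (\<lambda>i. \<Sum>k<n. M i k (\<xi> k))"
      using r by (simp add: hnorm_vec l2_scaleR)
    ultimately have "inverse r * l2 p (\<lambda>i. \<Sum>k<n. M i k (\<xi> k)) \<le> N"
      by (simp only:)
    then show ?thesis
      using r by (simp add: r_def [symmetric] field_simps)
  qed
  ultimately show "l2_bound p n M N"
    by (simp add: l2_bound_def)
  show "N \<le> a" if "l2_bound p n M a"
    unfolding N_def
  proof (rule cSUP_least)
    show "?B \<noteq> {}"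
      using zero by blast
    fix \<xi>
    assume \<xi>: "\<xi> \<in> ?B"
    have "?F \<xi> \<le> a * l2 n (\<lambda>k. \<xi> $ k)"
      using l2_boundD [OF that] by (simp add: hnorm_vec)
    also have "\<dots> \<le> a"
      using \<xi> l2_bound_nonneg [OF that] hnorm_eq_l2 [of \<xi> n] by (intro mult_left_le) auto
    finally show "?F \<xi> \<le> a" .
  qed
qed

lemma cmat_norm_l2_bound:
  assumes "\<alpha> \<in> carrier_mat p n"
  shows "l2_bound p n (\<lambda>i k. (*) (\<alpha> $$ (i, k))) (cmat_norm \<alpha>)"
    and "l2_bound p n (\<lambda>i k. (*) (\<alpha> $$ (i, k))) a \<Longrightarrow> cmat_norm \<alpha> \<le> a"
proof -
  have "\<alpha> *\<^sub>v \<xi> = vec p (\<lambda>i. \<Sum>k<n. \<alpha> $$ (i, k) * \<xi> $ k)" if "\<xi> \<in> carrier_vec n" for \<xi>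
    using assms that by (auto simp: scalar_prod_def lessThan_atLeast0 intro!: eq_vecI sum.cong)
  then have "cmat_norm \<alpha> = (SUP \<xi>\<in>{\<xi> \<in> carrier_vec n. hnorm \<xi> \<le> 1}.
      hnorm (vec p (\<lambda>i. \<Sum>k<n. \<alpha> $$ (i, k) * \<xi> $ k)))"
    using assms unfolding cmat_norm_def by (intro SUP_cong) auto
  then show "l2_bound p n (\<lambda>i k. (*) (\<alpha> $$ (i, k))) (cmat_norm \<alpha>)"
    and "l2_bound p n (\<lambda>i k. (*) (\<alpha> $$ (i, k))) a \<Longrightarrow> cmat_norm \<alpha> \<le> a"
    using operator_norm_l2_bound [of "\<lambda>i k. (*) (\<alpha> $$ (i, k))" p n] bounded_linear_mult_right by auto
qed

lemma opmat_norm_l2_bound: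
  assumes "x \<in> carrier_mat p n"
  shows "l2_bound p n (\<lambda>i k. blinfun_apply (x $$ (i, k))) (opmat_norm x)"
    and "l2_bound p n (\<lambda>i k. blinfun_apply (x $$ (i, k))) a \<Longrightarrow> opmat_norm x \<le> a"
proof -
  have "opmat_norm x = (SUP \<xi>\<in>{\<xi> \<in> carrier_vec n. hnorm \<xi> \<le> 1}.
      hnorm (vec p (\<lambda>i. \<Sum>k<n. blinfun_apply (x $$ (i, k)) (\<xi> $ k))))"
    using assms unfolding opmat_norm_def opmat_apply_def by auto
  then show "l2_bound p n (\<lambda>i k. blinfun_apply (x $$ (i, k))) (opmat_norm x)"
    and "l2_bound p n (\<lambda>i k. blinfun_apply (x $$ (i, k))) a \<Longrightarrow> opmat_norm x \<le> a"
    using operator_norm_l2_bound [of "\<lambda>i k. blinfun_apply (x $$ (i, k))" p n] blinfun.bounded_linear_right by auto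
qed

lemma l2_bound_scale:
  assumes "l2_bound p n M a" "0 \<le> r"
    and "\<And>i \<xi>. i < p \<Longrightarrow> norm (\<Sum>k<n. M' i k (\<xi> k)) \<le> r * norm (\<Sum>k<n. M i k (\<xi> k))"
  shows "l2_bound p n M' (r * a)"
  unfolding l2_bound_def
proof (intro conjI allI)
  show "0 \<le> r * a"
    using assms(2) l2_bound_nonneg [OF assms(1)] by simp
  fix \<xi>
  have "l2 p (\<lambda>i. \<Sum>k<n. M' i k (\<xi> k)) \<le> r * l2 p (\<lambda>i. \<Sum>k<n. M i k (\<xi> k))"
    by (intro l2_scale assms)
  also have "\<dots> \<le> r * (a * l2 n \<xi>)"
    by (intro mult_left_mono l2_boundD assms)
  finally show "l2 p (\<lambda>i. \<Sum>k<n. M' i k (\<xi> k)) \<le> r * a * l2 n \<xi>"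
    by (simp add: mult.assoc)
qed

definition block_diag ::
  "nat \<Rightarrow> nat \<Rightarrow> (nat \<Rightarrow> nat \<Rightarrow> 'a :: zero) \<Rightarrow> (nat \<Rightarrow> nat \<Rightarrow> 'a) \<Rightarrow> nat \<Rightarrow> nat \<Rightarrow> 'a" where
  "block_diag p n M M' i k =
    (if i < p then if k < n then M i k else 0 else if k < n then 0 else M' (i - p) (k - n))"

lemma block_diag_simps [simp]:
  "i < p \<Longrightarrow> k < n \<Longrightarrow> block_diag p n M M' i k = M i k"
  "i < p \<Longrightarrow> block_diag p n M M' i (n + k) = 0"
  "k < n \<Longrightarrow> block_diag p n M M' (p + i) k = 0"
  "block_diag p n M M' (p + i) (n + k) = M' i k"
  by (simp_all add: block_diag_def)

definition hcat :: "nat \<Rightarrow> (nat \<Rightarrow> nat \<Rightarrow> 'a) \<Rightarrow> (nat \<Rightarrow> nat \<Rightarrow> 'a) \<Rightarrow> nat \<Rightarrow> nat \<Rightarrow> 'a" where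
  "hcat n M M' i k = (if k < n then M i k else M' i (k - n))"

lemma hcat_simps [simp]:
  "k < n \<Longrightarrow> hcat n M M' i k = M i k" "hcat n M M' i (n + k) = M' i k"
  by (simp_all add: hcat_def)

definition vcat :: "nat \<Rightarrow> (nat \<Rightarrow> nat \<Rightarrow> 'a) \<Rightarrow> (nat \<Rightarrow> nat \<Rightarrow> 'a) \<Rightarrow> nat \<Rightarrow> nat \<Rightarrow> 'a" where
  "vcat p M M' i k = (if i < p then M i k else M' (i - p) k)"

lemma vcat_simps [simp]:
  "i < p \<Longrightarrow> vcat p M M' i k = M i k" "vcat p M M' (p + i) k = M' i k"
  by (simp_all add: vcat_def)

lemma l2_bound_block_diag:
  assumes M: "l2_bound p n (\<lambda>i k. op (M i k)) a" and M': "l2_bound p' n' (\<lambda>i k. op (M' i k)) a"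
    and op: "\<And>z. op 0 z = 0"
  shows "l2_bound (p + p') (n + n') (\<lambda>i k. op (block_diag p n M M' i k)) a"
  unfolding l2_bound_def
proof (intro conjI allI)
  show "0 \<le> a"
    using M by (rule l2_bound_nonneg)
  fix \<xi> :: "nat \<Rightarrow> 'a"
  let ?g = "\<lambda>i. \<Sum>k<n + n'. op (block_diag p n M M' i k) (\<xi> k)"
  have "l2 p ?g = l2 p (\<lambda>i. \<Sum>k<n. op (M i k) (\<xi> k))"
    by (intro l2_cong) (simp add: sum_lessThan_append op)
  moreover have "l2 p' (\<lambda>i. ?g (p + i)) = l2 p' (\<lambda>i. \<Sum>k<n'. op (M' i k) (\<xi> (n + k)))"
    by (intro l2_cong) (simp add: sum_lessThan_append op)
  ultimately show "l2 (p + p') ?g \<le> a * l2 (n + n') \<xi>"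
    using l2_append_le [of p ?g a "l2 n \<xi>" p' "l2 n' (\<lambda>k. \<xi> (n + k))"]
      l2_boundD [OF M, of \<xi>] l2_boundD [OF M', of "\<lambda>k. \<xi> (n + k)"] \<open>0 \<le> a\<close>
    by (simp add: l2_append [of n])
qed

text \<open>$\|M\xi + M'\xi'\| \le a\|\xi\| + b\|\xi'\|$, and the Cauchy-Schwarz inequality in the plane
  bounds this by $\sqrt{a^2 + b^2}$ times the norm of $(\xi, \xi')$.\<close>

lemma l2_bound_hcat:
  assumes M: "l2_bound p n (\<lambda>i k. op (M i k)) a" and M': "l2_bound p n' (\<lambda>i k. op (M' i k)) b"
  shows "l2_bound p (n + n') (\<lambda>i k. op (hcat n M M' i k)) (sqrt (a\<^sup>2 + b\<^sup>2))"
  unfolding l2_bound_def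
proof (intro conjI allI)
  fix \<xi> :: "nat \<Rightarrow> 'a"
  let ?X = "l2 n \<xi>" and ?Y = "l2 n' (\<lambda>k. \<xi> (n + k))"
  have "l2 p (\<lambda>i. \<Sum>k<n + n'. op (hcat n M M' i k) (\<xi> k))
      = l2 p (\<lambda>i. (\<Sum>k<n. op (M i k) (\<xi> k)) + (\<Sum>k<n'. op (M' i k) (\<xi> (n + k))))"
    by (intro l2_cong) (simp add: sum_lessThan_append)
  also have "\<dots> \<le> a * ?X + b * ?Y"
    using l2_boundD [OF M, of \<xi>] l2_boundD [OF M', of "\<lambda>k. \<xi> (n + k)"]
    by (intro order_trans [OF l2_triangle] add_mono)
  also have "\<dots> \<le> sqrt ((a\<^sup>2 + b\<^sup>2) * (?X\<^sup>2 + ?Y\<^sup>2))"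
  proof (rule real_le_rsqrt)
    have "(a\<^sup>2 + b\<^sup>2) * (?X\<^sup>2 + ?Y\<^sup>2) - (a * ?X + b * ?Y)\<^sup>2 = (a * ?Y - b * ?X)\<^sup>2"
      by (simp add: power2_eq_square algebra_simps)
    then show "(a * ?X + b * ?Y)\<^sup>2 \<le> (a\<^sup>2 + b\<^sup>2) * (?X\<^sup>2 + ?Y\<^sup>2)"
      using zero_le_power2 [of "a * ?Y - b * ?X"] by linarith
  qed
  finally show "l2 p (\<lambda>i. \<Sum>k<n + n'. op (hcat n M M' i k) (\<xi> k)) \<le> sqrt (a\<^sup>2 + b\<^sup>2) * l2 (n + n') \<xi>"
    by (simp add: l2_append [of n] real_sqrt_mult)
qed simp

lemma l2_bound_vcat:
  assumes M: "l2_bound p n (\<lambda>i k. op (M i k)) a" and M': "l2_bound p' n (\<lambda>i k. op (M' i k)) b"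
  shows "l2_bound (p + p') n (\<lambda>i k. op (vcat p M M' i k)) (sqrt (a\<^sup>2 + b\<^sup>2))"
  unfolding l2_bound_def
proof (intro conjI allI)
  fix \<xi> :: "nat \<Rightarrow> 'a"
  let ?g = "\<lambda>i. \<Sum>k<n. op (vcat p M M' i k) (\<xi> k)"
  have "l2 p ?g = l2 p (\<lambda>i. \<Sum>k<n. op (M i k) (\<xi> k))"
    by (intro l2_cong) simp
  then show "l2 (p + p') ?g \<le> sqrt (a\<^sup>2 + b\<^sup>2) * l2 n \<xi>"
    using l2_append_le [of p ?g "l2 n \<xi>" a p' b] l2_boundD [OF M, of \<xi>] l2_boundD [OF M', of \<xi>]
    by (simp add: mult.commute)
qed simp

lemma l2_bound_mult:
  assumes \<gamma>: "l2_bound q p (\<lambda>i j. (*) (\<gamma> i j)) b" and \<alpha>: "l2_bound p n (\<lambda>j k. (*) (\<alpha> j k)) a"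
  shows "l2_bound q n (\<lambda>i k. (*) (\<Sum>j<p. \<gamma> i j * \<alpha> j k :: 'a :: real_normed_field)) (b * a)"
  unfolding l2_bound_def
proof (intro conjI allI)
  show "0 \<le> b * a"
    using assms by (simp add: l2_bound_nonneg)
  fix \<xi>
  have "(\<Sum>k<n. (\<Sum>j<p. \<gamma> i j * \<alpha> j k) * \<xi> k) = (\<Sum>j<p. \<gamma> i j * (\<Sum>k<n. \<alpha> j k * \<xi> k))" for i
    unfolding sum_distrib_left sum_distrib_right by (subst sum.swap) (simp add: mult.assoc)
  then have "l2 q (\<lambda>i. \<Sum>k<n. (\<Sum>j<p. \<gamma> i j * \<alpha> j k) * \<xi> k) \<le> b * l2 p (\<lambda>j. \<Sum>k<n. \<alpha> j k * \<xi> k)"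
    using l2_boundD [OF \<gamma>] by simp
  also have "\<dots> \<le> b * (a * l2 n \<xi>)"
    by (intro mult_left_mono l2_boundD [OF \<alpha>] l2_bound_nonneg [OF \<gamma>])
  finally show "l2 q (\<lambda>i. \<Sum>k<n. (\<Sum>j<p. \<gamma> i j * \<alpha> j k) * \<xi> k) \<le> b * a * l2 n \<xi>"
    by (simp add: mult.assoc)
qed

text \<open>Left multiplication by this matrix selects the rows $s, \dots, s + p - 1$.\<close>

lemma l2_bound_coisometry:
  assumes "s + p \<le> n"
  shows "l2_bound p n (\<lambda>i k. (*) (of_bool (k = s + i) :: complex)) 1"
  unfolding l2_bound_def
proof (intro conjI allI)
  fix \<xi> :: "nat \<Rightarrow> complex"
  have "l2 p (\<lambda>i. \<Sum>k<n. of_bool (k = s + i) * \<xi> k) = l2 p (\<lambda>i. \<xi> (s + i))"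
    using assms by (intro l2_cong) simp
  also have "\<dots> \<le> l2 n \<xi>"
    by (rule l2_segment_le [OF assms])
  finally show "l2 p (\<lambda>i. \<Sum>k<n. of_bool (k = s + i) * \<xi> k) \<le> 1 * l2 n \<xi>"
    by simp
qed simp

lemma l2_bound_isometry:
  assumes "s + p \<le> n"
  shows "l2_bound n p (\<lambda>k i. (*) (of_bool (k = s + i) :: complex)) 1"
  unfolding l2_bound_def
proof (intro conjI allI)
  fix \<xi> :: "nat \<Rightarrow> complex"
  obtain r where n: "n = s + (p + r)"
    using assms le_Suc_ex [of "s + p" n] by (auto simp: add.assoc)
  let ?g = "\<lambda>k. \<Sum>i<p. of_bool (k = s + i) * \<xi> i"
  have "l2 s ?g = l2 s (\<lambda>_. 0 :: complex)"
    by (intro l2_cong sum.neutral) auto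
  moreover have "l2 p (\<lambda>i. ?g (s + i)) = l2 p \<xi>"
    by (intro l2_cong) simp
  moreover have "l2 r (\<lambda>i. ?g (s + (p + i))) = l2 r (\<lambda>_. 0 :: complex)"
    by (intro l2_cong sum.neutral) auto
  ultimately show "l2 n ?g \<le> 1 * l2 p \<xi>"
    unfolding n by (simp add: l2_append [of s] l2_append [of p])
qed simp

lemma l2_column_le:
  assumes M: "l2_bound p n M a" and l: "l < n" and zero: "\<And>i k. M i k 0 = 0"
  shows "l2 p (\<lambda>i. M i l z) \<le> a * norm z"
proof -
  let ?\<zeta> = "\<lambda>k. if k = l then z else 0"
  have "(\<Sum>k<n. M i k (?\<zeta> k)) = M i l z" for i
    using l by (subst sum.remove [of _ l]) (auto intro!: sum.neutral simp: zero)
  moreover have "l2 n ?\<zeta> = norm z"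
  proof -
    have "(l2 n ?\<zeta>)\<^sup>2 = (norm z)\<^sup>2"
      unfolding l2_power2 using l by (subst sum.remove [of _ l]) (auto intro!: sum.neutral)
    then show ?thesis
      by (simp add: power2_eq_iff_nonneg)
  qed
  ultimately show ?thesis
    using l2_boundD [OF M, of ?\<zeta>] by simp
qed

text \<open>The norm of a row $b$ is found by testing $M$ on a vector $\zeta$ made from the conjugates of
  the entries of $b$, for which the $i$-th coordinate of $M\zeta$ controls $\|b\|^2$. The constants
  $C$ and $D$ account for vectors $\xi$ and $\eta$ when $b$ consists of the numbers
  $\langle x_{ik}\xi, \eta\rangle$; for a scalar matrix both are $1$.\<close>

lemma l2_row_le:
  assumes M: "l2_bound p n M a" and i: "i < p" and D: "0 \<le> D" and C: "0 \<le> C"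
    and \<zeta>: "\<And>k. k < n \<Longrightarrow> norm (\<zeta> k) \<le> C * norm (b k)"
    and row: "(l2 n b)\<^sup>2 \<le> D * norm (\<Sum>k<n. M i k (\<zeta> k))"
  shows "l2 n b \<le> a * (C * D)"
proof (cases "l2 n b = 0")
  case True
  then show ?thesis
    using l2_bound_nonneg [OF M] D C by simp
next
  case False
  have "l2 n b * l2 n b \<le> D * norm (\<Sum>k<n. M i k (\<zeta> k))"
    using row by (simp add: power2_eq_square)
  also have "\<dots> \<le> D * (a * (C * l2 n b))"
  proof (rule mult_left_mono [OF _ D])
    have "norm (\<Sum>k<n. M i k (\<zeta> k)) \<le> l2 p (\<lambda>i. \<Sum>k<n. M i k (\<zeta> k))"
      using norm_le_l2 [OF i, of "\<lambda>i. \<Sum>k<n. M i k (\<zeta> k)"] by simp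
    also have "\<dots> \<le> a * l2 n \<zeta>"
      by (rule l2_boundD [OF M])
    also have "\<dots> \<le> a * (C * l2 n b)"
      by (intro mult_left_mono l2_scale \<zeta> C l2_bound_nonneg [OF M])
    finally show "norm (\<Sum>k<n. M i k (\<zeta> k)) \<le> a * (C * l2 n b)" .
  qed
  finally have "l2 n b * l2 n b \<le> (a * (C * D)) * l2 n b"
    by (simp add: mult_ac)
  moreover have "0 < l2 n b"
    using False by (simp add: order_less_le)
  ultimately show ?thesis
    by (rule mult_right_le_imp_le)
qed

lemma l2_complex_row_le:
  assumes "l2_bound p n (\<lambda>i k. (*) (\<alpha> i k :: complex)) a" "i < p"
  shows "l2 n (\<alpha> i) \<le> a"
proof -
  have "(\<Sum>k<n. \<alpha> i k * cnj (\<alpha> i k)) = complex_of_real ((l2 n (\<alpha> i))\<^sup>2)"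
    by (simp add: l2_power2 complex_norm_square del: of_real_power)
  then have "(l2 n (\<alpha> i))\<^sup>2 \<le> norm (\<Sum>k<n. \<alpha> i k * cnj (\<alpha> i k))"
    by (simp del: of_real_power)
  then show ?thesis
    using l2_row_le [OF assms, of 1 1 "\<lambda>k. cnj (\<alpha> i k)" "\<alpha> i"] by simp
qed

lemma l2_complex_column_le:
  assumes "l2_bound n p (\<lambda>k j. (*) (\<beta> k j :: complex)) a" "j < p"
  shows "l2 n (\<lambda>k. \<beta> k j) \<le> a"
  using l2_column_le [OF assms, of 1] by simp

text \<open>Complex linearity of the entries is essential: the test vector has the coordinates
  $\overline{b_l}\,\xi$, and the scalars $\overline{b_l}$ must pass through the operators.\<close>

lemma l2_operator_row_le:
  fixes x :: "nat \<Rightarrow> nat \<Rightarrow> 'h :: chilbert_space \<Rightarrow>\<^sub>L 'h"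
  assumes x: "l2_bound n n (\<lambda>k l. blinfun_apply (x k l)) a" and k: "k < n"
    and ops: "\<And>l. l < n \<Longrightarrow> x k l \<in> bounded_operators"
  shows "l2 n (\<lambda>l. cinner (x k l \<xi>) \<eta>) \<le> a * (norm \<xi> * norm \<eta>)"
proof -
  let ?b = "\<lambda>l. cinner (x k l \<xi>) \<eta>"
  have "complex_of_real ((l2 n ?b)\<^sup>2) = (\<Sum>l<n. ?b l * cnj (?b l))"
    by (simp add: l2_power2 complex_norm_square del: of_real_power)
  also have "\<dots> = cinner (\<Sum>l<n. x k l (cnj (?b l) *\<^sub>C \<xi>)) \<eta>"
    using ops by (simp add: cinner_sum_left bounded_operators_def cinner_scaleC_left mult.commute)
  finally have "(l2 n ?b)\<^sup>2 = cmod (cinner (\<Sum>l<n. x k l (cnj (?b l) *\<^sub>C \<xi>)) \<eta>)"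
    by (metis abs_power2 norm_of_real)
  also have "\<dots> \<le> norm \<eta> * norm (\<Sum>l<n. x k l (cnj (?b l) *\<^sub>C \<xi>))"
    by (simp add: cmod_cinner_le mult.commute [of "norm \<eta>"])
  finally show ?thesis
    using l2_row_le [OF x k, of "norm \<eta>" "norm \<xi>" "\<lambda>l. cnj (?b l) *\<^sub>C \<xi>" ?b]
    by (simp add: norm_scaleC)
qed

lemma l2_operator_column_le:
  fixes y :: "nat \<Rightarrow> nat \<Rightarrow> 'h :: chilbert_space \<Rightarrow>\<^sub>L 'h"
  assumes y: "l2_bound n n (\<lambda>k l. blinfun_apply (y k l)) a" and l: "l < n"
  shows "l2 n (\<lambda>k. cinner (y k l \<xi>) \<eta>) \<le> a * (norm \<xi> * norm \<eta>)"
proof -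
  have "l2 n (\<lambda>k. cinner (y k l \<xi>) \<eta>) \<le> norm \<eta> * l2 n (\<lambda>k. y k l \<xi>)"
    by (intro l2_scale) (simp_all add: cmod_cinner_le mult.commute [of "norm \<eta>"])
  also have "\<dots> \<le> norm \<eta> * (a * norm \<xi>)"
    using l2_column_le [OF y l, of \<xi>] by (intro mult_left_mono) auto
  finally show ?thesis
    by (simp add: mult_ac)
qed

text \<open>The Cauchy-Schwarz inequality over the pairs $(k, l)$ separates $\alpha_k A_{kl}$ from
  $\beta_l B_{kl}$. In the first factor the sum over $l$ is the norm of a row of $A$, in the second the
  sum over $k$ is the norm of a column of $B$. The same
  argument proves $\|A \circ B\| \le \|A\| \|B\|$ for Schur products.\<close>

lemma cmod_schur_form_le:
  fixes A B :: "nat \<Rightarrow> nat \<Rightarrow> complex"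
  assumes A: "\<And>k. k < n \<Longrightarrow> l2 n (A k) \<le> a" and B: "\<And>l. l < n \<Longrightarrow> l2 n (\<lambda>k. B k l) \<le> b"
    and \<alpha>: "l2 n \<alpha> \<le> s" and \<beta>: "l2 n \<beta> \<le> t" and nonneg: "0 \<le> a" "0 \<le> b" 
  shows "cmod (\<Sum>k<n. \<Sum>l<n. \<alpha> k * \<beta> l * (A k l * B k l)) \<le> (s * a) * (t * b)"
proof -
  let ?I = "{..<n} \<times> {..<n}"
  let ?f = "\<lambda>(k, l). cmod (\<alpha> k) * cmod (A k l)" and ?g = "\<lambda>(k, l). cmod (\<beta> l) * cmod (B k l)"
  have "0 \<le> s" "0 \<le> t"
    using \<alpha> \<beta> l2_nonneg order_trans by blast+
  have f: "L2_set ?f ?I \<le> s * a"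
  proof (rule power2_le_imp_le)
    have "(L2_set ?f ?I)\<^sup>2 = (\<Sum>k<n. \<Sum>l<n. (cmod (\<alpha> k))\<^sup>2 * (cmod (A k l))\<^sup>2)"
      by (simp add: L2_set_def sum_nonneg sum.cartesian_product power_mult_distrib case_prod_unfold)
    also have "\<dots> = (\<Sum>k<n. (cmod (\<alpha> k))\<^sup>2 * (l2 n (A k))\<^sup>2)"
      by (simp add: l2_power2 sum_distrib_left)
    also have "\<dots> \<le> (\<Sum>k<n. (cmod (\<alpha> k))\<^sup>2 * a\<^sup>2)"
      using A by (intro sum_mono mult_left_mono power_mono) auto
    also have "\<dots> = (l2 n \<alpha>)\<^sup>2 * a\<^sup>2"
      by (simp add: l2_power2 sum_distrib_right)
    also have "\<dots> \<le> (s * a)\<^sup>2"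
      unfolding power_mult_distrib using \<alpha> by (intro mult_right_mono power_mono) auto
    finally show "(L2_set ?f ?I)\<^sup>2 \<le> (s * a)\<^sup>2" .
  qed (use nonneg \<open>0 \<le> s\<close> in simp)
  have g: "L2_set ?g ?I \<le> t * b"
  proof (rule power2_le_imp_le)
    have "(L2_set ?g ?I)\<^sup>2 = (\<Sum>k<n. \<Sum>l<n. (cmod (\<beta> l))\<^sup>2 * (cmod (B k l))\<^sup>2)"
      by (simp add: L2_set_def sum_nonneg sum.cartesian_product power_mult_distrib case_prod_unfold)
    also have "\<dots> = (\<Sum>l<n. (cmod (\<beta> l))\<^sup>2 * (l2 n (\<lambda>k. B k l))\<^sup>2)"
      by (subst sum.swap) (simp add: l2_power2 sum_distrib_left)
    also have "\<dots> \<le> (\<Sum>l<n. (cmod (\<beta> l))\<^sup>2 * b\<^sup>2)"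
      using B by (intro sum_mono mult_left_mono power_mono) auto
    also have "\<dots> = (l2 n \<beta>)\<^sup>2 * b\<^sup>2"
      by (simp add: l2_power2 sum_distrib_right)
    also have "\<dots> \<le> (t * b)\<^sup>2"
      unfolding power_mult_distrib using \<beta> by (intro mult_right_mono power_mono) auto
    finally show "(L2_set ?g ?I)\<^sup>2 \<le> (t * b)\<^sup>2" .
  qed (use nonneg \<open>0 \<le> t\<close> in simp)
  have "(\<Sum>k<n. \<Sum>l<n. \<alpha> k * \<beta> l * (A k l * B k l))
      = (\<Sum>(k, l)\<in>?I. \<alpha> k * \<beta> l * (A k l * B k l))"
    by (simp add: sum.cartesian_product)
  also have "cmod \<dots> \<le> (\<Sum>i\<in>?I. \<bar>?f i\<bar> * \<bar>?g i\<bar>)"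
    by (intro order_trans [OF norm_sum] sum_mono) (auto simp: norm_mult mult_ac)
  also have "\<dots> \<le> L2_set ?f ?I * L2_set ?g ?I"
    by (rule L2_set_mult_ineq)
  also have "\<dots> \<le> (s * a) * (t * b)"
    using f g nonneg \<open>0 \<le> s\<close> by (intro mult_mono) auto
  finally show ?thesis .
qed

section \<open>Decompositions of evaluated tensor matrices\<close>

text \<open>The function $e$ is a $p \times p$ matrix of evaluated tensors, and $a, b, c, d$ bound the
  norms of the four factors. The factors are functions of their indices, which makes block
  constructions a matter of splitting sums.\<close>

definition schur_decomposition ::
  "('h :: chilbert_space \<Rightarrow>\<^sub>L 'h) set \<Rightarrow> ('k :: chilbert_space \<Rightarrow>\<^sub>L 'k) set \<Rightarrow> nat \<Rightarrow>
    ('h \<times> 'h \<times> 'k \<times> 'k \<Rightarrow> nat \<Rightarrow> nat \<Rightarrow> complex) \<Rightarrow> real \<Rightarrow> real \<Rightarrow> real \<Rightarrow> real \<Rightarrow> bool" where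
  "schur_decomposition V W p e a b c d \<longleftrightarrow> (\<exists>n \<alpha> x y \<beta>. 1 \<le> n \<and>
    (\<forall>k<n. \<forall>l<n. x k l \<in> V \<and> y k l \<in> W) \<and>
    l2_bound p n (\<lambda>i k. (*) (\<alpha> i k)) a \<and> l2_bound n n (\<lambda>k l. blinfun_apply (x k l)) b \<and>
    l2_bound n n (\<lambda>k l. blinfun_apply (y k l)) c \<and> l2_bound n p (\<lambda>l j. (*) (\<beta> l j)) d \<and>
    (\<forall>q. \<forall>i<p. \<forall>j<p. e q i j = (\<Sum>k<n. \<Sum>l<n. \<alpha> i k * \<beta> l j * vector_form q (x k l, y k l))))"

lemma schur_decompositionI:
  assumes "1 \<le> n" and "\<And>k l. k < n \<Longrightarrow> l < n \<Longrightarrow> x k l \<in> V" "\<And>k l. k < n \<Longrightarrow> l < n \<Longrightarrow> y k l \<in> W"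
    and "l2_bound p n (\<lambda>i k. (*) (\<alpha> i k)) a" "l2_bound n n (\<lambda>k l. blinfun_apply (x k l)) b"
    and "l2_bound n n (\<lambda>k l. blinfun_apply (y k l)) c" "l2_bound n p (\<lambda>l j. (*) (\<beta> l j)) d"
    and "\<And>q i j. i < p \<Longrightarrow> j < p \<Longrightarrow>
      e q i j = (\<Sum>k<n. \<Sum>l<n. \<alpha> i k * \<beta> l j * vector_form q (x k l, y k l))"
  shows "schur_decomposition V W p e a b c d"
  unfolding schur_decomposition_def using assms by blast

lemma schur_decompositionE:
  assumes "schur_decomposition V W p e a b c d"
  obtains n \<alpha> x y \<beta> where "1 \<le> n" and "\<And>k l. k < n \<Longrightarrow> l < n \<Longrightarrow> x k l \<in> V"
    "\<And>k l. k < n \<Longrightarrow> l < n \<Longrightarrow> y k l \<in> W"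
    "l2_bound p n (\<lambda>i k. (*) (\<alpha> i k)) a" "l2_bound n n (\<lambda>k l. blinfun_apply (x k l)) b"
    "l2_bound n n (\<lambda>k l. blinfun_apply (y k l)) c" "l2_bound n p (\<lambda>l j. (*) (\<beta> l j)) d"
    "\<And>q i j. i < p \<Longrightarrow> j < p \<Longrightarrow>
      e q i j = (\<Sum>k<n. \<Sum>l<n. \<alpha> i k * \<beta> l j * vector_form q (x k l, y k l))"
  using assms unfolding schur_decomposition_def
proof (elim exE conjE)
  fix n \<alpha> x y \<beta>
  assume "1 \<le> n" "\<forall>k<n. \<forall>l<n. x k l \<in> V \<and> y k l \<in> W"
    "l2_bound p n (\<lambda>i k. (*) (\<alpha> i k)) a" "l2_bound n n (\<lambda>k l. blinfun_apply (x k l)) b"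
    "l2_bound n n (\<lambda>k l. blinfun_apply (y k l)) c" "l2_bound n p (\<lambda>l j. (*) (\<beta> l j)) d"
    "\<forall>q. \<forall>i<p. \<forall>j<p. e q i j
      = (\<Sum>k<n. \<Sum>l<n. \<alpha> i k * \<beta> l j * vector_form q (x k l, y k l))"
  then show thesis
    by (intro that [of n x y \<alpha> \<beta>]) blast+
qed

lemma schur_decomposition_cong:
  assumes "\<And>q i j. i < p \<Longrightarrow> j < p \<Longrightarrow> e q i j = e' q i j"
  shows "schur_decomposition V W p e a b c d \<longleftrightarrow> schur_decomposition V W p e' a b c d"
  unfolding schur_decomposition_def using assms by simp

lemma schur_decomposition_mono:
  assumes "schur_decomposition V W p e a b c d" "a \<le> a'" "b \<le> b'" "c \<le> c'" "d \<le> d'"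
  shows "schur_decomposition V W p e a' b' c' d'"
  using assms(1)
proof (rule schur_decompositionE)
  fix n \<alpha> x y \<beta>
  assume n: "1 \<le> n" and mem: "\<And>k l. k < n \<Longrightarrow> l < n \<Longrightarrow> x k l \<in> V" "\<And>k l. k < n \<Longrightarrow> l < n \<Longrightarrow> y k l \<in> W"
    and bounds: "l2_bound p n (\<lambda>i k. (*) (\<alpha> i k)) a" "l2_bound n n (\<lambda>k l. blinfun_apply (x k l)) b"
    "l2_bound n n (\<lambda>k l. blinfun_apply (y k l)) c" "l2_bound n p (\<lambda>l j. (*) (\<beta> l j)) d"
    and e: "\<And>q i j. i < p \<Longrightarrow> j < p \<Longrightarrow>
      e q i j = (\<Sum>k<n. \<Sum>l<n. \<alpha> i k * \<beta> l j * vector_form q (x k l, y k l))"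
  show ?thesis
    by (rule schur_decompositionI [OF n mem l2_bound_mono [OF bounds(1) assms(2)] l2_bound_mono [OF bounds(2) assms(3)]
          l2_bound_mono [OF bounds(3) assms(4)] l2_bound_mono [OF bounds(4) assms(5)] e])
qed

text \<open>The definiteness of the Schur norm rests on this estimate: each entry, evaluated at fixed
  vectors, is controlled by the product of the four norms.\<close>

lemma schur_decomposition_bound:
  fixes V :: "('h :: chilbert_space \<Rightarrow>\<^sub>L 'h) set" and W :: "('k :: chilbert_space \<Rightarrow>\<^sub>L 'k) set"
  assumes dec: "schur_decomposition V W p e a b c d" and V: "V \<subseteq> bounded_operators"
    and ij: "i < p" "j < p"
  shows "cmod (e (\<xi>, \<eta>, \<xi>', \<eta>') i j) \<le> a * b * c * d * (norm \<xi> * norm \<eta> * norm \<xi>' * norm \<eta>')"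
proof -
  obtain n \<alpha> x y \<beta> where "\<And>k l. k < n \<Longrightarrow> l < n \<Longrightarrow> x k l \<in> V"
    and \<alpha>: "l2_bound p n (\<lambda>i k. (*) (\<alpha> i k)) a" and x: "l2_bound n n (\<lambda>k l. blinfun_apply (x k l)) b"
    and y: "l2_bound n n (\<lambda>k l. blinfun_apply (y k l)) c" and \<beta>: "l2_bound n p (\<lambda>l j. (*) (\<beta> l j)) d"
    and e: "e (\<xi>, \<eta>, \<xi>', \<eta>') i j
      = (\<Sum>k<n. \<Sum>l<n. \<alpha> i k * \<beta> l j * vector_form (\<xi>, \<eta>, \<xi>', \<eta>') (x k l, y k l))"
    using dec ij by (elim schur_decompositionE) blast
  then have ops: "x k l \<in> bounded_operators" if "k < n" "l < n" for k l
    using V that by blast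
  have "cmod (e (\<xi>, \<eta>, \<xi>', \<eta>') i j) \<le> (a * (b * (norm \<xi> * norm \<eta>))) * (d * (c * (norm \<xi>' * norm \<eta>')))"
    unfolding e vector_form_def prod.case
  proof (rule cmod_schur_form_le)
    show "l2 n (\<lambda>l. cinner (x k l \<xi>) \<eta>) \<le> b * (norm \<xi> * norm \<eta>)" if "k < n" for k
      by (rule l2_operator_row_le [OF x that ops [OF that]])
    show "l2 n (\<lambda>k. cinner (y k l \<xi>') \<eta>') \<le> c * (norm \<xi>' * norm \<eta>')" if "l < n" for l
      by (rule l2_operator_column_le [OF y that])
    show "l2 n (\<alpha> i) \<le> a"
      by (rule l2_complex_row_le [OF \<alpha> ij(1)])
    show "l2 n (\<lambda>k. \<beta> k j) \<le> d"
      by (rule l2_complex_column_le [OF \<beta> ij(2)])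
  qed (simp_all add: l2_bound_nonneg [OF x] l2_bound_nonneg [OF y])
  then show ?thesis
    by (simp add: mult_ac)
qed

lemma sum_rotate:
  "(\<Sum>l\<in>B. \<Sum>r\<in>C. \<Sum>s\<in>D. G l r s) = (\<Sum>r\<in>C. \<Sum>s\<in>D. \<Sum>l\<in>B. G l r s)"
  by (subst sum.swap) (intro sum.cong refl sum.swap)

lemma sum_swap_pairs:
  "(\<Sum>k\<in>A. \<Sum>l\<in>B. \<Sum>r\<in>C. \<Sum>s\<in>D. F k l r s) = (\<Sum>r\<in>C. \<Sum>s\<in>D. \<Sum>k\<in>A. \<Sum>l\<in>B. F k l r s)"
proof -
  have "(\<Sum>k\<in>A. \<Sum>l\<in>B. \<Sum>r\<in>C. \<Sum>s\<in>D. F k l r s) = (\<Sum>k\<in>A. \<Sum>r\<in>C. \<Sum>s\<in>D. \<Sum>l\<in>B. F k l r s)"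
    by (intro sum.cong refl sum_rotate)
  also have "\<dots> = (\<Sum>r\<in>C. \<Sum>s\<in>D. \<Sum>k\<in>A. \<Sum>l\<in>B. F k l r s)"
    by (rule sum_rotate)
  finally show ?thesis .
qed

lemma schur_decomposition_sandwich:
  assumes dec: "schur_decomposition V W m e a b c d"
    and \<gamma>: "l2_bound p m (\<lambda>i k. (*) (\<gamma> i k)) g" and \<delta>: "l2_bound m p (\<lambda>l j. (*) (\<delta> l j)) h"
  shows "schur_decomposition V W p (\<lambda>q i j. \<Sum>k<m. \<Sum>l<m. \<gamma> i k * \<delta> l j * e q k l) (g * a) b c (d * h)"
proof -
  obtain n \<alpha> x y \<beta> where n: "1 \<le> n" and xV: "\<And>k l. k < n \<Longrightarrow> l < n \<Longrightarrow> x k l \<in> V"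
    and yW: "\<And>k l. k < n \<Longrightarrow> l < n \<Longrightarrow> y k l \<in> W"
    and \<alpha>: "l2_bound m n (\<lambda>i k. (*) (\<alpha> i k)) a" and x: "l2_bound n n (\<lambda>k l. blinfun_apply (x k l)) b"
    and y: "l2_bound n n (\<lambda>k l. blinfun_apply (y k l)) c" and \<beta>: "l2_bound n m (\<lambda>l j. (*) (\<beta> l j)) d"
    and e: "\<And>q i j. i < m \<Longrightarrow> j < m \<Longrightarrow>
      e q i j = (\<Sum>k<n. \<Sum>l<n. \<alpha> i k * \<beta> l j * vector_form q (x k l, y k l))"
    using dec by (elim schur_decompositionE) blast
  show ?thesis
  proof (rule schur_decompositionI [OF n xV yW l2_bound_mult [OF \<gamma> \<alpha>] x y l2_bound_mult [OF \<beta> \<delta>]])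
    fix q i j
    let ?f = "\<lambda>r s. vector_form q (x r s, y r s)"
    have "(\<Sum>k<m. \<Sum>l<m. \<gamma> i k * \<delta> l j * e q k l)
        = (\<Sum>k<m. \<Sum>l<m. \<Sum>r<n. \<Sum>s<n. (\<gamma> i k * \<alpha> k r) * (\<beta> s l * \<delta> l j) * ?f r s)"
      by (intro sum.cong) (simp_all add: e sum_distrib_left mult_ac)
    also have "\<dots> = (\<Sum>r<n. \<Sum>s<n. \<Sum>k<m. \<Sum>l<m. (\<gamma> i k * \<alpha> k r) * (\<beta> s l * \<delta> l j) * ?f r s)"
      by (rule sum_swap_pairs)
    also have "\<dots> = (\<Sum>r<n. \<Sum>s<n. (\<Sum>k<m. \<gamma> i k * \<alpha> k r) * (\<Sum>l<m. \<beta> s l * \<delta> l j) * ?f r s)"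
      unfolding sum_product by (simp add: sum_distrib_right)
    finally show "(\<Sum>k<m. \<Sum>l<m. \<gamma> i k * \<delta> l j * e q k l) = \<dots>" .
  qed
qed

lemma l2_bound_block_diag_operators:
  fixes x :: "nat \<Rightarrow> nat \<Rightarrow> 'a :: chilbert_space \<Rightarrow>\<^sub>L 'a"
  assumes "l2_bound p n (\<lambda>k l. blinfun_apply (x k l)) a" "l2_bound p' n' (\<lambda>k l. blinfun_apply (x' k l)) a"
  shows "l2_bound (p + p') (n + n') (\<lambda>k l. blinfun_apply (block_diag p n x x' k l)) a"
  using l2_bound_block_diag [of p n blinfun_apply, OF assms] by simp

lemma block_diag_mem:
  assumes "0 \<in> S" "\<And>k l. k < n \<Longrightarrow> l < n \<Longrightarrow> x k l \<in> S" "\<And>k l. k < n' \<Longrightarrow> l < n' \<Longrightarrow> x' k l \<in> S"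
    and "k < n + n'" "l < n + n'"
  shows "block_diag n n x x' k l \<in> S"
  using assms by (auto simp: block_diag_def)

lemma schur_decomposition_elementary:
  assumes vw: "v \<in> V" "w \<in> W" and "i0 < p" "j0 < p"
  shows "schur_decomposition V W p (\<lambda>q i j. of_bool (i = i0 \<and> j = j0) * vector_form q (v, w)) 1 (norm v) (norm w) 1"
proof -
  have single: "l2_bound 1 1 (\<lambda>_ _. blinfun_apply T) (norm T)" for T :: "'c :: chilbert_space \<Rightarrow>\<^sub>L 'c"
    by (simp add: l2_bound_def l2_def lessThan_Suc norm_blinfun)
  have column: "l2_bound p 1 (\<lambda>i k. (*) (of_bool (i = i0 + k) :: complex)) 1"
    and row: "l2_bound 1 p (\<lambda>l j. (*) (of_bool (j = j0 + l) :: complex)) 1"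
    using assms by (auto intro!: l2_bound_isometry l2_bound_coisometry)
  show ?thesis
    by (rule schur_decompositionI [OF order_refl vw column single single row]) simp
qed

abbreviation tmat_eval where "tmat_eval u \<equiv> \<lambda>q i j. tensor_eval q (u $$ (i, j))"

lemma matrices_index: "u \<in> matrices p S \<Longrightarrow> i < p \<Longrightarrow> j < p \<Longrightarrow> u $$ (i, j) \<in> S"
  unfolding matrices_def using elements_matI [of u p p i j] by blast

lemma matricesI: "u \<in> carrier_mat p p \<Longrightarrow> (\<And>i j. i < p \<Longrightarrow> j < p \<Longrightarrow> u $$ (i, j) \<in> S) \<Longrightarrow> u \<in> matrices p S"
  by (auto simp: matrices_def)

context tensor_of_subspaces
begin

lemma scaleR_mem: "v \<in> V \<Longrightarrow> r *\<^sub>R v \<in> V" "w \<in> W \<Longrightarrow> r *\<^sub>R w \<in> W"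
  using V W by (simp_all add: scaleR_scaleC complex_module.subspace_scale)

lemma vector_form_zero [simp]: "vector_form q (0, 0) = 0"
  by (cases q) (simp add: vector_form_def)

text \<open>$\alpha(x \circ y)\beta + \alpha'(x' \circ y')\beta'$ has the inner factors $x \oplus x'$ and
  $y \oplus y'$, which remain contractions, and the outer factors $[\alpha\ \alpha']$ and its column
  analogue, whose squared norms are at most the sums of the squared norms.\<close>

lemma schur_decomposition_add:
  assumes "schur_decomposition V W p e s 1 1 s" "schur_decomposition V W p e' t 1 1 t"
  shows "schur_decomposition V W p (\<lambda>q i j. e q i j + e' q i j)
    (sqrt (s\<^sup>2 + t\<^sup>2)) 1 1 (sqrt (s\<^sup>2 + t\<^sup>2))"
proof -
  obtain n \<alpha> x y \<beta> where n: "1 \<le> n" and xV: "\<And>k l. k < n \<Longrightarrow> l < n \<Longrightarrow> x k l \<in> V"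
    and yW: "\<And>k l. k < n \<Longrightarrow> l < n \<Longrightarrow> y k l \<in> W"
    and \<alpha>: "l2_bound p n (\<lambda>i k. (*) (\<alpha> i k)) s" and x: "l2_bound n n (\<lambda>k l. blinfun_apply (x k l)) 1"
    and y: "l2_bound n n (\<lambda>k l. blinfun_apply (y k l)) 1" and \<beta>: "l2_bound n p (\<lambda>l j. (*) (\<beta> l j)) s"
    and e: "\<And>q i j. i < p \<Longrightarrow> j < p \<Longrightarrow>
      e q i j = (\<Sum>k<n. \<Sum>l<n. \<alpha> i k * \<beta> l j * vector_form q (x k l, y k l))"
    using assms(1) by (elim schur_decompositionE) blast
  obtain n' \<alpha>' x' y' \<beta>' where xV': "\<And>k l. k < n' \<Longrightarrow> l < n' \<Longrightarrow> x' k l \<in> V"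
    and yW': "\<And>k l. k < n' \<Longrightarrow> l < n' \<Longrightarrow> y' k l \<in> W"
    and \<alpha>': "l2_bound p n' (\<lambda>i k. (*) (\<alpha>' i k)) t" and x': "l2_bound n' n' (\<lambda>k l. blinfun_apply (x' k l)) 1"
    and y': "l2_bound n' n' (\<lambda>k l. blinfun_apply (y' k l)) 1" and \<beta>': "l2_bound n' p (\<lambda>l j. (*) (\<beta>' l j)) t"
    and e': "\<And>q i j. i < p \<Longrightarrow> j < p \<Longrightarrow>
      e' q i j = (\<Sum>k<n'. \<Sum>l<n'. \<alpha>' i k * \<beta>' l j * vector_form q (x' k l, y' k l))"
    using assms(2) by (elim schur_decompositionE) blast
  show ?thesis
  proof (rule schur_decompositionI [OF _ _ _ _ l2_bound_block_diag_operators [OF x x']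
        l2_bound_block_diag_operators [OF y y']])
    show "1 \<le> n + n'"
      using n by simp
    show "block_diag n n x x' k l \<in> V" if "k < n + n'" "l < n + n'" for k l
      by (rule block_diag_mem [OF complex_module.subspace_0 [OF V] xV xV' that])
    show "block_diag n n y y' k l \<in> W" if "k < n + n'" "l < n + n'" for k l
      by (rule block_diag_mem [OF complex_module.subspace_0 [OF W] yW yW' that])
    show "l2_bound p (n + n') (\<lambda>i k. (*) (hcat n \<alpha> \<alpha>' i k)) (sqrt (s\<^sup>2 + t\<^sup>2))"
      by (rule l2_bound_hcat [OF \<alpha> \<alpha>'])
    show "l2_bound (n + n') p (\<lambda>l j. (*) (vcat n \<beta> \<beta>' l j)) (sqrt (s\<^sup>2 + t\<^sup>2))"
      by (rule l2_bound_vcat [OF \<beta> \<beta>'])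
    show "e q i j + e' q i j = (\<Sum>k<n + n'. \<Sum>l<n + n'. hcat n \<alpha> \<alpha>' i k * vcat n \<beta> \<beta>' l j *
        vector_form q (block_diag n n x x' k l, block_diag n n y y' k l))" if "i < p" "j < p" for q i j
      using that by (simp add: sum_lessThan_append e e')
  qed
qed

text \<open>Here all four factors are put on the block diagonal, which does not increase the bounds. The
  mixed blocks of the Schur product are $0 \otimes 0 = 0$.\<close>

lemma schur_decomposition_dsum:
  assumes "schur_decomposition V W p e s 1 1 s" "schur_decomposition V W p' e' s 1 1 s"
  shows "schur_decomposition V W (p + p') (\<lambda>q. block_diag p p (e q) (e' q)) s 1 1 s"
proof -
  obtain n \<alpha> x y \<beta> where n: "1 \<le> n" and xV: "\<And>k l. k < n \<Longrightarrow> l < n \<Longrightarrow> x k l \<in> V"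
    and yW: "\<And>k l. k < n \<Longrightarrow> l < n \<Longrightarrow> y k l \<in> W"
    and \<alpha>: "l2_bound p n (\<lambda>i k. (*) (\<alpha> i k)) s" and x: "l2_bound n n (\<lambda>k l. blinfun_apply (x k l)) 1"
    and y: "l2_bound n n (\<lambda>k l. blinfun_apply (y k l)) 1" and \<beta>: "l2_bound n p (\<lambda>l j. (*) (\<beta> l j)) s"
    and e: "\<And>q i j. i < p \<Longrightarrow> j < p \<Longrightarrow>
      e q i j = (\<Sum>k<n. \<Sum>l<n. \<alpha> i k * \<beta> l j * vector_form q (x k l, y k l))"
    using assms(1) by (elim schur_decompositionE) blast
  obtain n' \<alpha>' x' y' \<beta>' where xV': "\<And>k l. k < n' \<Longrightarrow> l < n' \<Longrightarrow> x' k l \<in> V"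
    and yW': "\<And>k l. k < n' \<Longrightarrow> l < n' \<Longrightarrow> y' k l \<in> W"
    and \<alpha>': "l2_bound p' n' (\<lambda>i k. (*) (\<alpha>' i k)) s" and x': "l2_bound n' n' (\<lambda>k l. blinfun_apply (x' k l)) 1"
    and y': "l2_bound n' n' (\<lambda>k l. blinfun_apply (y' k l)) 1" and \<beta>': "l2_bound n' p' (\<lambda>l j. (*) (\<beta>' l j)) s"
    and e': "\<And>q i j. i < p' \<Longrightarrow> j < p' \<Longrightarrow>
      e' q i j = (\<Sum>k<n'. \<Sum>l<n'. \<alpha>' i k * \<beta>' l j * vector_form q (x' k l, y' k l))"
    using assms(2) by (elim schur_decompositionE) blast
  show ?thesis
  proof (rule schur_decompositionI [OF _ _ _ _ l2_bound_block_diag_operators [OF x x']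
        l2_bound_block_diag_operators [OF y y']])
    show "1 \<le> n + n'"
      using n by simp
    show "block_diag n n x x' k l \<in> V" if "k < n + n'" "l < n + n'" for k l
      by (rule block_diag_mem [OF complex_module.subspace_0 [OF V] xV xV' that])
    show "block_diag n n y y' k l \<in> W" if "k < n + n'" "l < n + n'" for k l
      by (rule block_diag_mem [OF complex_module.subspace_0 [OF W] yW yW' that])
    show "l2_bound (p + p') (n + n') (\<lambda>i k. (*) (block_diag p n \<alpha> \<alpha>' i k)) s"
      by (rule l2_bound_block_diag [OF \<alpha> \<alpha>']) simp
    show "l2_bound (n + n') (p + p') (\<lambda>l j. (*) (block_diag n p \<beta> \<beta>' l j)) s"
      by (rule l2_bound_block_diag [OF \<beta> \<beta>']) simp
    fix q i j
    assume ij: "i < p + p'" "j < p + p'"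
    show "block_diag p p (e q) (e' q) i j =
        (\<Sum>k<n + n'. \<Sum>l<n + n'. block_diag p n \<alpha> \<alpha>' i k * block_diag n p \<beta> \<beta>' l j *
          vector_form q (block_diag n n x x' k l, block_diag n n y y' k l))"
    proof (cases "i < p")
      case i: True
      show ?thesis
      proof (cases "j < p")
        case True
        with i show ?thesis
          by (simp add: sum_lessThan_append e)
      next
        case False
        then obtain r where "j = p + r"
          using le_Suc_ex not_less by blast
        with i show ?thesis
          by (simp add: sum_lessThan_append)
      qed
    next
      case False
      then obtain r where i: "i = p + r" "r < p'"
        using le_Suc_ex [of p i] ij(1) by auto
      show ?thesis
      proof (cases "j < p")
        case True
        with i show ?thesis
          by (simp add: sum_lessThan_append)
      next
        case False
        then obtain r' where "j = p + r'" "r' < p'"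
          using le_Suc_ex [of p j] ij(2) by auto
        with i show ?thesis
          by (simp add: sum_lessThan_append e')
      qed
    qed
  qed
qed

text \<open>Dividing $x$ by $b$ and $y$ by $c$ makes them contractions; multiplying $\alpha$ by $s/a$ and
  $\beta$ by $s/d$ gives both the bound $s$. The total factor is $s^2/(abcd) = 1$.\<close>

lemma schur_decomposition_normalize:
  assumes dec: "schur_decomposition V W p e a b c d" and pos: "0 < a" "0 < b" "0 < c" "0 < d"
  defines "s \<equiv> sqrt (a * b * c * d)"
  shows "schur_decomposition V W p e s 1 1 s"
proof -
  obtain n \<alpha> x y \<beta> where n: "1 \<le> n" and xV: "\<And>k l. k < n \<Longrightarrow> l < n \<Longrightarrow> x k l \<in> V"
    and yW: "\<And>k l. k < n \<Longrightarrow> l < n \<Longrightarrow> y k l \<in> W"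
    and \<alpha>: "l2_bound p n (\<lambda>i k. (*) (\<alpha> i k)) a" and x: "l2_bound n n (\<lambda>k l. blinfun_apply (x k l)) b"
    and y: "l2_bound n n (\<lambda>k l. blinfun_apply (y k l)) c" and \<beta>: "l2_bound n p (\<lambda>l j. (*) (\<beta> l j)) d"
    and e: "\<And>q i j. i < p \<Longrightarrow> j < p \<Longrightarrow>
      e q i j = (\<Sum>k<n. \<Sum>l<n. \<alpha> i k * \<beta> l j * vector_form q (x k l, y k l))"
    using dec by (elim schur_decompositionE) blast
  have s: "0 < s" "s * s = a * b * c * d"
    using pos by (simp_all add: s_def)
  have scale: "l2_bound p' n' (\<lambda>i k z. r *\<^sub>R M i k z) (r * a')" if "l2_bound p' n' M a'" "0 \<le> r"
    for p' n' M a' and r :: real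
    by (rule l2_bound_scale [OF that]) (simp add: scaleR_sum_right [symmetric] that(2))
  have times: "(*) (r *\<^sub>R z) = (\<lambda>w. r *\<^sub>R (z * w))" for r and z :: complex
    by (simp add: fun_eq_iff)
  have mem: "(1 / b) *\<^sub>R x k l \<in> V" "(1 / c) *\<^sub>R y k l \<in> W" if "k < n" "l < n" for k l
    using that by (simp_all add: scaleR_mem xV yW)
  have \<alpha>1: "l2_bound p n (\<lambda>i k. (*) ((s / a) *\<^sub>R \<alpha> i k)) s"
    using scale [OF \<alpha>, of "s / a"] pos s unfolding times by simp
  have \<beta>1: "l2_bound n p (\<lambda>l j. (*) ((s / d) *\<^sub>R \<beta> l j)) s"
    using scale [OF \<beta>, of "s / d"] pos s unfolding times by simp
  have x1: "l2_bound n n (\<lambda>k l. blinfun_apply ((1 / b) *\<^sub>R x k l)) 1"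
    using scale [OF x, of "1 / b"] pos by (simp add: scaleR_blinfun.rep_eq)
  have y1: "l2_bound n n (\<lambda>k l. blinfun_apply ((1 / c) *\<^sub>R y k l)) 1"
    using scale [OF y, of "1 / c"] pos by (simp add: scaleR_blinfun.rep_eq)
  show ?thesis
  proof (rule schur_decompositionI [OF n mem \<alpha>1 x1 y1 \<beta>1])
    fix q i j
    assume ij: "i < p" "j < p"
    have "complex_of_real (s / a) * complex_of_real (s / d) * (complex_of_real (1 / b) * complex_of_real (1 / c))
        = complex_of_real ((s * s) / (a * b * c * d))"
      by simp
    then have one: "complex_of_real (s / a) * complex_of_real (s / d)
        * (complex_of_real (1 / b) * complex_of_real (1 / c)) = 1"
      using pos by (simp only: s(2)) simp
    have "((s / a) *\<^sub>R \<alpha> i k) * ((s / d) *\<^sub>R \<beta> l j) * vector_form q ((1 / b) *\<^sub>R x k l, (1 / c) *\<^sub>R y k l)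
        = (complex_of_real (s / a) * complex_of_real (s / d) * (complex_of_real (1 / b) * complex_of_real (1 / c)))
          * (\<alpha> i k * \<beta> l j * vector_form q (x k l, y k l))" for k l
      unfolding scaleR_scaleC vector_form_scale_left vector_form_scale_right
      by (simp only: scaleR_conv_of_real mult_ac)
    then show "e q i j = (\<Sum>k<n. \<Sum>l<n. ((s / a) *\<^sub>R \<alpha> i k) * ((s / d) *\<^sub>R \<beta> l j) *
        vector_form q ((1 / b) *\<^sub>R x k l, (1 / c) *\<^sub>R y k l))"
      by (simp only: one mult_1_left e [OF ij])
  qed
qed

lemma schur_decomposition_zero:
  "schur_decomposition V W p (\<lambda>_ _ _. 0) 0 0 0 0"
proof (rule schur_decompositionI [OF order_refl])
  show "(\<lambda>_ _. 0) k l \<in> V" "(\<lambda>_ _. 0) k l \<in> W" for k l :: nat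
    using V W by (simp_all add: complex_module.subspace_0)
  show "l2_bound p 1 (\<lambda>i k. (*) ((\<lambda>_ _. 0 :: complex) i k)) 0" "l2_bound 1 p (\<lambda>l j. (*) ((\<lambda>_ _. 0 :: complex) l j)) 0"
    by (simp_all add: l2_bound_def)
  show "l2_bound 1 1 (\<lambda>k l. blinfun_apply ((\<lambda>_ _. 0 :: 'h \<Rightarrow>\<^sub>L 'h) k l)) 0"
    "l2_bound 1 1 (\<lambda>k l. blinfun_apply ((\<lambda>_ _. 0 :: 'k \<Rightarrow>\<^sub>L 'k) k l)) 0"
    by (simp_all add: l2_bound_def)
qed simp

definition has_schur_decomposition where
  "has_schur_decomposition p e \<longleftrightarrow> (\<exists>s. schur_decomposition V W p e s 1 1 s)"

lemma has_schur_decomposition_cong: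
  assumes "\<And>q i j. i < p \<Longrightarrow> j < p \<Longrightarrow> e q i j = e' q i j" and "has_schur_decomposition p e"
  shows "has_schur_decomposition p e'"
  using assms(2) unfolding has_schur_decomposition_def
  by (simp only: schur_decomposition_cong [of p e e', OF assms(1)])

lemma has_schur_decomposition_zero: "has_schur_decomposition p (\<lambda>_ _ _. 0)"
  unfolding has_schur_decomposition_def
  by (rule exI [of _ 0], rule schur_decomposition_mono [OF schur_decomposition_zero]) simp_all

lemma has_schur_decomposition_add:
  "has_schur_decomposition p e \<Longrightarrow> has_schur_decomposition p e' \<Longrightarrow>
    has_schur_decomposition p (\<lambda>q i j. e q i j + e' q i j)"
  unfolding has_schur_decomposition_def by (elim exE) (rule exI, rule schur_decomposition_add)

lemma has_schur_decomposition_sum: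
  "(\<And>t. t \<in> I \<Longrightarrow> has_schur_decomposition p (e t)) \<Longrightarrow>
    has_schur_decomposition p (\<lambda>q i j. \<Sum>t\<in>I. e t q i j)"
proof (induction I rule: infinite_finite_induct)
  case (insert t I)
  have "has_schur_decomposition p (\<lambda>q i j. e t q i j + (\<Sum>t\<in>I. e t q i j))"
    by (rule has_schur_decomposition_add) (simp_all add: insert)
  then show ?case
    using insert.hyps by simp
qed (simp_all add: has_schur_decomposition_zero)

text \<open>The norms of $v$ and $w$ may vanish, so they are increased by $1$ before normalizing.\<close>

lemma has_schur_decomposition_elementary:
  assumes "v \<in> V" "w \<in> W" "i0 < p" "j0 < p"
  shows "has_schur_decomposition p (\<lambda>q i j. of_bool (i = i0 \<and> j = j0) * vector_form q (v, w))"
proof -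
  have "schur_decomposition V W p (\<lambda>q i j. of_bool (i = i0 \<and> j = j0) * vector_form q (v, w))
      1 (norm v + 1) (norm w + 1) 1"
    by (rule schur_decomposition_mono [OF schur_decomposition_elementary [OF assms]]) simp_all
  moreover have "0 < norm v + 1" "0 < norm w + 1"
    by (simp_all add: add_nonneg_pos)
  ultimately show ?thesis
    unfolding has_schur_decomposition_def
    by (intro exI) (rule schur_decomposition_normalize, assumption, simp_all)
qed

text \<open>A tensor matrix is a finite sum of matrices with one elementary tensor in one entry. Each of
  these has a decomposition with $1 \times 1$ inner factors, and decompositions can be added.\<close>

lemma has_schur_decomposition_tensor_matrix:
  assumes u: "u \<in> matrices p (tensor_product V W)"
  shows "has_schur_decomposition p (tmat_eval u)"
proof -
  have entry: "has_schur_decomposition p (\<lambda>q i j. of_bool (i = i0 \<and> j = j0) * tensor_eval q (u $$ (i0, j0)))"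
    if ij: "i0 < p" "j0 < p" for i0 j0
  proof -
    obtain ps where ps: "set ps \<subseteq> V \<times> W" "\<And>q. tensor_eval q (u $$ (i0, j0)) = (\<Sum>p\<leftarrow>ps. vector_form q p)"
      using tensor_eq_sum_elem_tensors [OF matrices_index [OF u ij]] by blast
    show ?thesis
      unfolding ps(2) using ps(1)
    proof (induction ps)
      case Nil
      then show ?case
        by (simp add: has_schur_decomposition_zero)
    next
      case (Cons vw ps)
      then show ?case
        using has_schur_decomposition_add [OF has_schur_decomposition_elementary [OF _ _ ij, of "fst vw" "snd vw"]
            Cons.IH]
        by (simp add: distrib_left mem_Times_iff)
    qed
  qed
  have "has_schur_decomposition p (\<lambda>q i j. \<Sum>i0<p. \<Sum>j0<p. of_bool (i = i0 \<and> j = j0) * tensor_eval q (u $$ (i0, j0)))"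
    by (intro has_schur_decomposition_sum entry) simp_all
  then show ?thesis
  proof (rule has_schur_decomposition_cong [rotated])
    fix q i j
    assume ij: "i < p" "j < p"
    have "of_bool (i = i0 \<and> j = j0) * tensor_eval q (u $$ (i0, j0))
        = (if i0 = i then if j0 = j then tensor_eval q (u $$ (i, j)) else 0 else 0)" for i0 j0
      by simp
    then show "(\<Sum>i0<p. \<Sum>j0<p. of_bool (i = i0 \<and> j = j0) * tensor_eval q (u $$ (i0, j0))) = tmat_eval u q i j"
      using ij by (simp add: if_distrib [of "sum _"] sum.If_cases)
  qed
qed

section \<open>Entries of sandwiches and Schur products\<close>

lemma tmat_sandwich_index:
  assumes u: "u \<in> matrices m (tensor_product V W)" and \<alpha>: "\<alpha> \<in> carrier_mat p m"
    and \<beta>: "\<beta> \<in> carrier_mat m p" and ij: "i < p" "j < p"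
  shows "tmat_sandwich V W \<alpha> u \<beta> $$ (i, j) \<in> tensor_product V W"
    and "tensor_eval q (tmat_sandwich V W \<alpha> u \<beta> $$ (i, j))
      = (\<Sum>k<m. \<Sum>l<m. \<alpha> $$ (i, k) * \<beta> $$ (l, j) * tensor_eval q (u $$ (k, l)))"
proof -
  let ?t = "\<lambda>(k, l). tensor_scale V W (\<alpha> $$ (i, k) * \<beta> $$ (l, j)) (u $$ (k, l))"
  have dim: "dim_row u = m" "dim_col u = m"
    using u by (auto simp: matrices_def)
  have entry: "tmat_sandwich V W \<alpha> u \<beta> $$ (i, j) = tensor_sum V W ?t ({..<m} \<times> {..<m})"
    using \<alpha> \<beta> ij by (simp add: tmat_sandwich_def dim)
  have t: "?t kl \<in> tensor_product V W" if "kl \<in> {..<m} \<times> {..<m}" for kl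
    using that by (auto intro!: tensor_scale matrices_index [OF u])
  show "tmat_sandwich V W \<alpha> u \<beta> $$ (i, j) \<in> tensor_product V W"
    unfolding entry by (rule tensor_sum(1) [OF t])
  have "tensor_eval q (tmat_sandwich V W \<alpha> u \<beta> $$ (i, j)) = (\<Sum>kl\<in>{..<m} \<times> {..<m}. tensor_eval q (?t kl))"
    unfolding entry by (rule tensor_sum(2) [OF t])
  also have "\<dots> = (\<Sum>k<m. \<Sum>l<m. \<alpha> $$ (i, k) * \<beta> $$ (l, j) * tensor_eval q (u $$ (k, l)))"
    unfolding sum.cartesian_product
    by (intro sum.cong) (auto simp: tensor_scale(2) [OF matrices_index [OF u]])
  finally show "tensor_eval q (tmat_sandwich V W \<alpha> u \<beta> $$ (i, j)) = \<dots>" .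
qed

lemma schur_product_index:
  assumes x: "x \<in> matrices n V" and y: "y \<in> matrices n W"
  shows "schur_product V W x y \<in> matrices n (tensor_product V W)"
    and "k < n \<Longrightarrow> l < n \<Longrightarrow>
      tensor_eval q (schur_product V W x y $$ (k, l)) = vector_form q (x $$ (k, l), y $$ (k, l))"
proof -
  have dim: "dim_row x = n" "dim_col x = n"
    using x by (auto simp: matrices_def)
  note el = elem_tensor [OF matrices_index [OF x] matrices_index [OF y]]
  show "schur_product V W x y \<in> matrices n (tensor_product V W)"
    by (rule matricesI) (simp_all add: schur_product_def dim el(1))
  show "tensor_eval q (schur_product V W x y $$ (k, l)) = vector_form q (x $$ (k, l), y $$ (k, l))"
    if "k < n" "l < n"
    using that by (simp add: schur_product_def dim el(2))
qed

lemma tensor_matrix_eqI: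
  assumes "u \<in> matrices p (tensor_product V W)" "u' \<in> matrices p (tensor_product V W)"
    and "\<And>q i j. i < p \<Longrightarrow> j < p \<Longrightarrow> tensor_eval q (u $$ (i, j)) = tensor_eval q (u' $$ (i, j))"
  shows "u = u'"
proof (rule eq_matI)
  show "dim_row u = dim_row u'" "dim_col u = dim_col u'"
    using assms(1,2) by (auto simp: matrices_def)
  fix i j
  assume "i < dim_row u'" "j < dim_col u'"
  then have "i < p" "j < p"
    using assms(2) by (auto simp: matrices_def)
  then show "u $$ (i, j) = u' $$ (i, j)"
    using assms by (intro tensor_eqI matrices_index)
qed

section \<open>The Schur norm as an infimum\<close>

definition schur_values :: "('h \<Rightarrow>\<^sub>L 'h, 'k \<Rightarrow>\<^sub>L 'k) tensor mat \<Rightarrow> real set" where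
  "schur_values u = {cmat_norm \<alpha> * opmat_norm x * opmat_norm y * cmat_norm \<beta> | n \<alpha> x y \<beta>.
      1 \<le> n \<and> x \<in> matrices n V \<and> y \<in> matrices n W \<and>
      \<alpha> \<in> carrier_mat (dim_row u) n \<and> \<beta> \<in> carrier_mat n (dim_col u) \<and>
      u = tmat_sandwich V W \<alpha> (schur_product V W x y) \<beta>}"

lemma schur_values_decomposition:
  assumes u: "u \<in> matrices p (tensor_product V W)" and r: "r \<in> schur_values u"
  obtains a b c d where "0 \<le> a" "0 \<le> b" "0 \<le> c" "0 \<le> d" "r = a * b * c * d"
    "schur_decomposition V W p (tmat_eval u) a b c d"
proof -
  have dim: "dim_row u = p" "dim_col u = p"
    using u by (auto simp: matrices_def)
  obtain n \<alpha> x y \<beta> where r: "r = cmat_norm \<alpha> * opmat_norm x * opmat_norm y * cmat_norm \<beta>"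
    and n: "1 \<le> n" and x: "x \<in> matrices n V" and y: "y \<in> matrices n W"
    and \<alpha>: "\<alpha> \<in> carrier_mat p n" and \<beta>: "\<beta> \<in> carrier_mat n p"
    and ueq: "u = tmat_sandwich V W \<alpha> (schur_product V W x y) \<beta>"
    using r unfolding schur_values_def dim by blast
  have carrier: "x \<in> carrier_mat n n" "y \<in> carrier_mat n n"
    using x y by (simp_all add: matrices_def)
  note bounds = cmat_norm_l2_bound(1) [OF \<alpha>] opmat_norm_l2_bound(1) [OF carrier(1)]
    opmat_norm_l2_bound(1) [OF carrier(2)] cmat_norm_l2_bound(1) [OF \<beta>]
  have "schur_decomposition V W p (tmat_eval u) (cmat_norm \<alpha>) (opmat_norm x) (opmat_norm y) (cmat_norm \<beta>)"
  proof (rule schur_decompositionI [OF n matrices_index [OF x] matrices_index [OF y] bounds])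
    show "tensor_eval q (u $$ (i, j)) = (\<Sum>k<n. \<Sum>l<n. \<alpha> $$ (i, k) * \<beta> $$ (l, j) *
        vector_form q (x $$ (k, l), y $$ (k, l)))" if "i < p" "j < p" for q i j
      unfolding ueq tmat_sandwich_index(2) [OF schur_product_index(1) [OF x y] \<alpha> \<beta> that]
      by (intro sum.cong) (simp_all add: schur_product_index(2) [OF x y])
  qed
  with r show thesis
    using that bounds l2_bound_nonneg by metis
qed

lemma schur_decomposition_values:
  assumes u: "u \<in> matrices p (tensor_product V W)"
    and dec: "schur_decomposition V W p (tmat_eval u) a b c d"
  obtains r where "r \<in> schur_values u" "r \<le> a * b * c * d"
proof -
  have dim: "dim_row u = p" "dim_col u = p"
    using u by (auto simp: matrices_def)
  obtain n \<alpha> x y \<beta> where n: "1 \<le> n" and xV: "\<And>k l. k < n \<Longrightarrow> l < n \<Longrightarrow> x k l \<in> V"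
    and yW: "\<And>k l. k < n \<Longrightarrow> l < n \<Longrightarrow> y k l \<in> W"
    and \<alpha>: "l2_bound p n (\<lambda>i k. (*) (\<alpha> i k)) a" and x: "l2_bound n n (\<lambda>k l. blinfun_apply (x k l)) b"
    and y: "l2_bound n n (\<lambda>k l. blinfun_apply (y k l)) c" and \<beta>: "l2_bound n p (\<lambda>l j. (*) (\<beta> l j)) d"
    and e: "\<And>q i j. i < p \<Longrightarrow> j < p \<Longrightarrow> tensor_eval q (u $$ (i, j))
      = (\<Sum>k<n. \<Sum>l<n. \<alpha> i k * \<beta> l j * vector_form q (x k l, y k l))"
    using dec by (elim schur_decompositionE) blast
  let ?\<alpha> = "mat p n (\<lambda>(i, k). \<alpha> i k)" and ?\<beta> = "mat n p (\<lambda>(l, j). \<beta> l j)"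
  let ?x = "mat n n (\<lambda>(k, l). x k l)" and ?y = "mat n n (\<lambda>(k, l). y k l)"
  have carrier: "?\<alpha> \<in> carrier_mat p n" "?\<beta> \<in> carrier_mat n p" "?x \<in> carrier_mat n n" "?y \<in> carrier_mat n n"
    by simp_all
  have mem: "?x \<in> matrices n V" "?y \<in> matrices n W"
    using xV yW by (auto intro!: matricesI)
  have "u = tmat_sandwich V W ?\<alpha> (schur_product V W ?x ?y) ?\<beta>"
  proof (rule tensor_matrix_eqI [OF u])
    note sandwich = tmat_sandwich_index [OF schur_product_index(1) [OF mem] carrier(1,2)]
    show "tmat_sandwich V W ?\<alpha> (schur_product V W ?x ?y) ?\<beta> \<in> matrices p (tensor_product V W)"
      by (rule matricesI [OF _ sandwich(1)]) (simp_all add: tmat_sandwich_def)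
    show "tensor_eval q (u $$ (i, j))
        = tensor_eval q (tmat_sandwich V W ?\<alpha> (schur_product V W ?x ?y) ?\<beta> $$ (i, j))"
      if "i < p" "j < p" for q i j
      unfolding sandwich(2) [OF that] e [OF that] using that
      by (intro sum.cong) (simp_all add: schur_product_index(2) [OF mem])
  qed
  then have "cmat_norm ?\<alpha> * opmat_norm ?x * opmat_norm ?y * cmat_norm ?\<beta> \<in> schur_values u"
    unfolding schur_values_def dim using n mem carrier(1,2) by blast
  moreover have "cmat_norm ?\<alpha> * opmat_norm ?x * opmat_norm ?y * cmat_norm ?\<beta> \<le> a * b * c * d"
  proof (intro mult_mono)
    have cong: "l2_bound p n (\<lambda>i k. (*) (?\<alpha> $$ (i, k))) a" "l2_bound n p (\<lambda>i k. (*) (?\<beta> $$ (i, k))) d"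
      "l2_bound n n (\<lambda>i k. blinfun_apply (?x $$ (i, k))) b"
      "l2_bound n n (\<lambda>i k. blinfun_apply (?y $$ (i, k))) c"
      using \<alpha> \<beta> x y by (simp_all cong: l2_bound_cong)
    show "cmat_norm ?\<alpha> \<le> a" "cmat_norm ?\<beta> \<le> d"
      by (rule cmat_norm_l2_bound(2) [OF carrier(1) cong(1)], rule cmat_norm_l2_bound(2) [OF carrier(2) cong(2)])
    show "opmat_norm ?x \<le> b" "opmat_norm ?y \<le> c"
      by (rule opmat_norm_l2_bound(2) [OF carrier(3) cong(3)], rule opmat_norm_l2_bound(2) [OF carrier(4) cong(4)])
  qed (use l2_bound_nonneg [OF \<alpha>] l2_bound_nonneg [OF x] l2_bound_nonneg [OF y]
      l2_bound_nonneg [OF cmat_norm_l2_bound(1) [OF carrier(2)]]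
      l2_bound_nonneg [OF opmat_norm_l2_bound(1) [OF carrier(3)]]
      l2_bound_nonneg [OF opmat_norm_l2_bound(1) [OF carrier(4)]] in simp_all)
  ultimately show thesis
    by (rule that)
qed

lemma schur_norm_eq: "schur_norm V W u = Inf (schur_values u)"
  by (simp add: schur_norm_def schur_values_def)

lemma schur_values_nonneg:
  "u \<in> matrices p (tensor_product V W) \<Longrightarrow> r \<in> schur_values u \<Longrightarrow> 0 \<le> r"
  by (metis schur_values_decomposition mult_nonneg_nonneg)

lemma schur_values_nonempty: "u \<in> matrices p (tensor_product V W) \<Longrightarrow> schur_values u \<noteq> {}"
  using has_schur_decomposition_tensor_matrix schur_decomposition_values
  unfolding has_schur_decomposition_def by (metis empty_iff)

lemma schur_norm_nonneg: "u \<in> matrices p (tensor_product V W) \<Longrightarrow> 0 \<le> schur_norm V W u"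
  unfolding schur_norm_eq by (intro cInf_greatest schur_values_nonempty schur_values_nonneg)

lemma schur_norm_le:
  assumes u: "u \<in> matrices p (tensor_product V W)"
    and "schur_decomposition V W p (tmat_eval u) a b c d"
  shows "schur_norm V W u \<le> a * b * c * d"
proof -
  obtain r where r: "r \<in> schur_values u" "r \<le> a * b * c * d"
    using schur_decomposition_values [OF assms] by blast
  have "bdd_below (schur_values u)"
    using schur_values_nonneg [OF u] by (rule bdd_belowI)
  then show ?thesis
    using r cInf_lower unfolding schur_norm_eq by fastforce
qed

text \<open>Some decomposition has a product of norms below $r$. Its norms may vanish, so each is increased
  by a small $\varepsilon$ that keeps the product below $r$, and the result is normalized.\<close>

lemma schur_norm_less_decomposition:
  assumes u: "u \<in> matrices p (tensor_product V W)" and less: "schur_norm V W u < r"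
  shows "schur_decomposition V W p (tmat_eval u) (sqrt r) 1 1 (sqrt r)"
proof -
  obtain r' where r': "r' \<in> schur_values u" "r' < r"
    using less cInf_lessD [OF schur_values_nonempty [OF u]] unfolding schur_norm_eq by blast
  obtain a b c d where nonneg: "0 \<le> a" "0 \<le> b" "0 \<le> c" "0 \<le> d" and r'_eq: "r' = a * b * c * d"
    and dec: "schur_decomposition V W p (tmat_eval u) a b c d"
    using schur_values_decomposition [OF u r'(1)] by blast
  have "((\<lambda>\<epsilon>. (a + \<epsilon>) * (b + \<epsilon>) * (c + \<epsilon>) * (d + \<epsilon>)) \<longlongrightarrow> (a + 0) * (b + 0) * (c + 0) * (d + 0)) (at_right 0)"
    by (intro tendsto_intros)
  then have "\<forall>\<^sub>F \<epsilon> in at_right 0. (a + \<epsilon>) * (b + \<epsilon>) * (c + \<epsilon>) * (d + \<epsilon>) < r"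
    using r' r'_eq by (intro order_tendstoD) auto
  moreover have "\<forall>\<^sub>F \<epsilon> in at_right 0. (0 :: real) < \<epsilon>"
    by (rule eventually_at_right_less)
  ultimately have "\<forall>\<^sub>F \<epsilon> in at_right 0. (a + \<epsilon>) * (b + \<epsilon>) * (c + \<epsilon>) * (d + \<epsilon>) < r \<and> 0 < \<epsilon>"
    by eventually_elim simp
  then obtain \<epsilon> where \<epsilon>: "(a + \<epsilon>) * (b + \<epsilon>) * (c + \<epsilon>) * (d + \<epsilon>) < r" "0 < \<epsilon>"
    using eventually_happens trivial_limit_at_right_real by blast
  have "schur_decomposition V W p (tmat_eval u) (a + \<epsilon>) (b + \<epsilon>) (c + \<epsilon>) (d + \<epsilon>)"
    using \<epsilon>(2) by (intro schur_decomposition_mono [OF dec]) simp_all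
  then have "schur_decomposition V W p (tmat_eval u) (sqrt ((a + \<epsilon>) * (b + \<epsilon>) * (c + \<epsilon>) * (d + \<epsilon>))) 1 1
      (sqrt ((a + \<epsilon>) * (b + \<epsilon>) * (c + \<epsilon>) * (d + \<epsilon>)))"
    using \<epsilon>(2) nonneg by (intro schur_decomposition_normalize) simp_all
  then show ?thesis
    using \<epsilon>(1) by (elim schur_decomposition_mono) simp_all
qed

section \<open>The axioms of an operator space matrix norm\<close>

text \<open>The matrix $v = \gamma u \delta$ is given by its evaluations, and $\gamma$, $\delta$ are
  functions of their indices. In this form the inequality also yields homogeneity ($\gamma = c I$) and
  the lower bound for direct sums ($\gamma$ and $\delta$ cut out a diagonal block).\<close>

lemma schur_norm_sandwich_le:
  assumes u: "u \<in> matrices m (tensor_product V W)" and v: "v \<in> matrices p (tensor_product V W)"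
    and \<gamma>: "l2_bound p m (\<lambda>i k. (*) (\<gamma> i k)) g" and \<delta>: "l2_bound m p (\<lambda>l j. (*) (\<delta> l j)) h"
    and eval: "\<And>q i j. i < p \<Longrightarrow> j < p \<Longrightarrow> tensor_eval q (v $$ (i, j))
      = (\<Sum>k<m. \<Sum>l<m. \<gamma> i k * \<delta> l j * tensor_eval q (u $$ (k, l)))"
  shows "schur_norm V W v \<le> g * schur_norm V W u * h"
proof -
  have "schur_norm V W v \<le> (g * h) * r" if r: "schur_norm V W u < r" for r
  proof -
    have "0 < r"
      using r schur_norm_nonneg [OF u] by linarith
    have "schur_decomposition V W p (\<lambda>q i j. \<Sum>k<m. \<Sum>l<m. \<gamma> i k * \<delta> l j * tensor_eval q (u $$ (k, l)))
        (g * sqrt r) 1 1 (sqrt r * h)"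
      by (rule schur_decomposition_sandwich [OF schur_norm_less_decomposition [OF u r] \<gamma> \<delta>])
    then have "schur_decomposition V W p (tmat_eval v) (g * sqrt r) 1 1 (sqrt r * h)"
      by (simp only: schur_decomposition_cong [of p "tmat_eval v", OF eval])
    from schur_norm_le [OF v this] show ?thesis
      using \<open>0 < r\<close> by (simp add: mult_ac)
  qed
  moreover have "((\<lambda>r. (g * h) * r) \<longlongrightarrow> (g * h) * schur_norm V W u) (at_right (schur_norm V W u))"
    by (intro tendsto_intros)
  ultimately have "schur_norm V W v \<le> (g * h) * schur_norm V W u"
    by (intro tendsto_lowerbound) (auto simp: eventually_at_right_less intro: eventually_mono [OF eventually_at_right_less])
  then show ?thesis
    by (simp add: mult_ac)
qed

lemma tmat_zero: "tmat_zero V W p p \<in> matrices p (tensor_product V W)"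
  "i < p \<Longrightarrow> j < p \<Longrightarrow> tensor_eval q (tmat_zero V W p p $$ (i, j)) = 0"
  by (rule matricesI) (simp_all add: tmat_zero_def tensor_zero)

lemma tmat_add:
  assumes "u \<in> matrices p (tensor_product V W)" "u' \<in> matrices p (tensor_product V W)"
  shows "tmat_add V W u u' \<in> matrices p (tensor_product V W)"
    and "i < p \<Longrightarrow> j < p \<Longrightarrow> tensor_eval q (tmat_add V W u u' $$ (i, j))
      = tensor_eval q (u $$ (i, j)) + tensor_eval q (u' $$ (i, j))"
proof -
  have dim: "dim_row u = p" "dim_col u = p"
    using assms by (auto simp: matrices_def)
  note add = tensor_add [OF matrices_index [OF assms(1)] matrices_index [OF assms(2)]]
  show "tmat_add V W u u' \<in> matrices p (tensor_product V W)"
    by (rule matricesI) (simp_all add: tmat_add_def dim add)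
  show "i < p \<Longrightarrow> j < p \<Longrightarrow> tensor_eval q (tmat_add V W u u' $$ (i, j))
      = tensor_eval q (u $$ (i, j)) + tensor_eval q (u' $$ (i, j))"
    by (simp add: tmat_add_def dim add)
qed

lemma tmat_scale:
  assumes "u \<in> matrices p (tensor_product V W)"
  shows "tmat_scale V W c u \<in> matrices p (tensor_product V W)"
    and "i < p \<Longrightarrow> j < p \<Longrightarrow> tensor_eval q (tmat_scale V W c u $$ (i, j)) = c * tensor_eval q (u $$ (i, j))"
proof -
  have dim: "dim_row u = p" "dim_col u = p"
    using assms by (auto simp: matrices_def)
  note scale = tensor_scale [OF matrices_index [OF assms]]
  show "tmat_scale V W c u \<in> matrices p (tensor_product V W)"
    by (rule matricesI) (simp_all add: tmat_scale_def dim scale carrier_matI)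
  show "i < p \<Longrightarrow> j < p \<Longrightarrow> tensor_eval q (tmat_scale V W c u $$ (i, j)) = c * tensor_eval q (u $$ (i, j))"
    by (simp add: tmat_scale_def dim scale)
qed

lemma tmat_dsum:
  assumes "u \<in> matrices m (tensor_product V W)" "u' \<in> matrices n (tensor_product V W)"
  shows "tmat_dsum V W u u' \<in> matrices (m + n) (tensor_product V W)"
    and "i < m + n \<Longrightarrow> j < m + n \<Longrightarrow> tensor_eval q (tmat_dsum V W u u' $$ (i, j))
      = block_diag m m (tmat_eval u q) (tmat_eval u' q) i j"
proof -
  have dim: "dim_row u = m" "dim_col u = m" "dim_row u' = n" "dim_col u' = n"
    using assms by (auto simp: matrices_def)
  show "tmat_dsum V W u u' \<in> matrices (m + n) (tensor_product V W)"
  proof (rule matricesI)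
    show "tmat_dsum V W u u' \<in> carrier_mat (m + n) (m + n)"
      by (simp add: tmat_dsum_def dim carrier_matI)
    show "tmat_dsum V W u u' $$ (i, j) \<in> tensor_product V W" if "i < m + n" "j < m + n" for i j
      using that by (auto simp: tmat_dsum_def dim tmat_zero_def tensor_zero
          intro!: matrices_index [OF assms(1)] matrices_index [OF assms(2)])
  qed
  show "i < m + n \<Longrightarrow> j < m + n \<Longrightarrow> tensor_eval q (tmat_dsum V W u u' $$ (i, j))
      = block_diag m m (tmat_eval u q) (tmat_eval u' q) i j"
    by (simp add: tmat_dsum_def dim tmat_zero_def tensor_zero block_diag_def)
qed

lemma schur_norm_zero: "schur_norm V W (tmat_zero V W p p) = 0"
proof -
  have "schur_decomposition V W p (tmat_eval (tmat_zero V W p p)) 0 0 0 0"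
    using schur_decomposition_zero
    by (simp only: schur_decomposition_cong [of p "tmat_eval (tmat_zero V W p p)", OF tmat_zero(2)])
  from schur_norm_le [OF tmat_zero(1) this] show ?thesis
    using schur_norm_nonneg [OF tmat_zero(1), of p] by simp
qed

text \<open>Every $r > 0$ exceeds the norm, so by the entry estimate each evaluation of each entry is at
  most $r$ times a constant.\<close>

lemma schur_norm_eq_zero_imp:
  assumes u: "u \<in> matrices p (tensor_product V W)" and ops: "V \<subseteq> bounded_operators"
    and zero: "schur_norm V W u = 0"
  shows "u = tmat_zero V W p p"
proof (rule tensor_matrix_eqI [OF u tmat_zero(1)])
  fix q :: "'h \<times> 'h \<times> 'k \<times> 'k" and i j
  assume ij: "i < p" "j < p"
  obtain \<xi> \<eta> \<xi>' \<eta>' where q: "q = (\<xi>, \<eta>, \<xi>', \<eta>')"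
    by (metis surj_pair)
  let ?C = "norm \<xi> * norm \<eta> * norm \<xi>' * norm \<eta>'"
  have "cmod (tensor_eval q (u $$ (i, j))) \<le> r * ?C" if "0 < r" for r
  proof -
    have "schur_decomposition V W p (tmat_eval u) (sqrt r) 1 1 (sqrt r)"
      using that zero by (intro schur_norm_less_decomposition [OF u]) simp
    from schur_decomposition_bound [OF this ops ij] show ?thesis
      using that by (simp add: q)
  qed
  moreover have "((\<lambda>r. r * ?C) \<longlongrightarrow> 0 * ?C) (at_right 0)"
    by (intro tendsto_intros)
  ultimately have "cmod (tensor_eval q (u $$ (i, j))) \<le> 0 * ?C"
    by (intro tendsto_lowerbound) (auto intro: eventually_mono [OF eventually_at_right_less])
  then show "tensor_eval q (u $$ (i, j)) = tensor_eval q (tmat_zero V W p p $$ (i, j))"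
    using ij by (simp add: tmat_zero(2))
qed

lemma sum_of_bool_of_bool_mult:
  fixes E :: "nat \<Rightarrow> nat \<Rightarrow> complex"
  assumes "a < m" "b < m"
  shows "(\<Sum>k<m. \<Sum>l<m. of_bool (k = a) * of_bool (l = b) * E k l) = E a b"
  using assms by (simp add: mult.assoc sum_distrib_left [symmetric])

lemma schur_norm_scale_le:
  assumes u: "u \<in> matrices p (tensor_product V W)"
  shows "schur_norm V W (tmat_scale V W c u) \<le> cmod c * schur_norm V W u"
proof -
  have I: "l2_bound p p (\<lambda>l j. (*) (of_bool (l = 0 + j) :: complex)) 1"
    by (rule l2_bound_isometry) simp
  have "l2_bound p p (\<lambda>i k. (*) (c * of_bool (k = 0 + i))) (cmod c * 1)"
    by (rule l2_bound_scale [OF l2_bound_coisometry [of 0 p p]])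
      (simp_all add: mult.assoc sum_distrib_left [symmetric] norm_mult)
  from schur_norm_sandwich_le [OF u tmat_scale(1) [OF u] this I] show ?thesis
    using sum_of_bool_of_bool_mult
    by (simp add: tmat_scale(2) [OF u] mult.assoc sum_distrib_left [symmetric])
qed

text \<open>The reverse inequality is the same estimate for $u = c^{-1}(cu)$.\<close>

lemma schur_norm_scale:
  assumes u: "u \<in> matrices p (tensor_product V W)"
  shows "schur_norm V W (tmat_scale V W c u) = cmod c * schur_norm V W u"
proof (rule antisym [OF schur_norm_scale_le [OF u]])
  note cu = tmat_scale [OF u, where c = c]
  show "cmod c * schur_norm V W u \<le> schur_norm V W (tmat_scale V W c u)"
  proof (cases "c = 0")
    case True
    then show ?thesis
      using schur_norm_nonneg [OF cu(1)] by simp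
  next
    case False
    have "tmat_scale V W (inverse c) (tmat_scale V W c u) = u"
      using False by (intro tensor_matrix_eqI [OF tmat_scale(1) [OF cu(1)] u])
        (simp add: tmat_scale(2) [OF cu(1)] cu(2))
    then have "schur_norm V W u \<le> cmod (inverse c) * schur_norm V W (tmat_scale V W c u)"
      using schur_norm_scale_le [OF cu(1), where c = "inverse c"] by simp
    then show ?thesis
      using False by (simp add: norm_divide field_simps)
  qed
qed

lemma schur_norm_triangle:
  assumes u: "u \<in> matrices p (tensor_product V W)" and u': "u' \<in> matrices p (tensor_product V W)"
  shows "schur_norm V W (tmat_add V W u u') \<le> schur_norm V W u + schur_norm V W u'"
proof (rule field_le_epsilon)
  fix \<epsilon> :: real
  assume \<epsilon>: "0 < \<epsilon>"
  define r r' where "r = schur_norm V W u + \<epsilon> / 2" and "r' = schur_norm V W u' + \<epsilon> / 2"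
  have pos: "0 \<le> r" "0 \<le> r'"
    using \<epsilon> schur_norm_nonneg [OF u] schur_norm_nonneg [OF u'] by (simp_all add: r_def r'_def)
  have "schur_decomposition V W p (\<lambda>q i j. tmat_eval u q i j + tmat_eval u' q i j)
      (sqrt ((sqrt r)\<^sup>2 + (sqrt r')\<^sup>2)) 1 1 (sqrt ((sqrt r)\<^sup>2 + (sqrt r')\<^sup>2))"
    using \<epsilon> by (intro schur_decomposition_add schur_norm_less_decomposition u u') (simp_all add: r_def r'_def)
  then have "schur_decomposition V W p (tmat_eval (tmat_add V W u u')) (sqrt (r + r')) 1 1 (sqrt (r + r'))"
    using pos by (simp add: schur_decomposition_cong [of p "tmat_eval (tmat_add V W u u')", OF tmat_add(2) [OF u u']])
  from schur_norm_le [OF tmat_add(1) [OF u u'] this]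
  show "schur_norm V W (tmat_add V W u u') \<le> schur_norm V W u + schur_norm V W u' + \<epsilon>"
    using pos by (simp add: r_def r'_def)
qed

lemma schur_norm_dsum:
  assumes u: "u \<in> matrices m (tensor_product V W)" and u': "u' \<in> matrices n (tensor_product V W)"
  shows "schur_norm V W (tmat_dsum V W u u') = max (schur_norm V W u) (schur_norm V W u')"
proof (rule antisym)
  note dsum = tmat_dsum [OF u u']
  show "schur_norm V W (tmat_dsum V W u u') \<le> max (schur_norm V W u) (schur_norm V W u')"
  proof (rule dense_ge)
    fix r
    assume r: "max (schur_norm V W u) (schur_norm V W u') < r"
    then have "0 \<le> r"
      using schur_norm_nonneg [OF u] by simp
    have "schur_decomposition V W (m + n) (\<lambda>q. block_diag m m (tmat_eval u q) (tmat_eval u' q))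
        (sqrt r) 1 1 (sqrt r)"
      using r by (intro schur_decomposition_dsum schur_norm_less_decomposition u u') simp_all
    then have "schur_decomposition V W (m + n) (tmat_eval (tmat_dsum V W u u')) (sqrt r) 1 1 (sqrt r)"
      by (simp only: schur_decomposition_cong [of "m + n" "tmat_eval (tmat_dsum V W u u')", OF dsum(2)])
    from schur_norm_le [OF dsum(1) this] show "schur_norm V W (tmat_dsum V W u u') \<le> r"
      using \<open>0 \<le> r\<close> by simp
  qed
  have compress: "schur_norm V W v \<le> schur_norm V W (tmat_dsum V W u u')"
    if v: "v \<in> matrices p (tensor_product V W)" and s: "s + p \<le> m + n"
      and eval: "\<And>q i j. i < p \<Longrightarrow> j < p \<Longrightarrow>
        tensor_eval q (v $$ (i, j)) = tensor_eval q (tmat_dsum V W u u' $$ (s + i, s + j))" for v p s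
    using schur_norm_sandwich_le [OF dsum(1) v l2_bound_coisometry [OF s] l2_bound_isometry [OF s]] s
    by (simp add: eval sum_of_bool_of_bool_mult)
  have "schur_norm V W u \<le> schur_norm V W (tmat_dsum V W u u')"
    by (rule compress [OF u, of 0]) (simp_all add: dsum(2))
  moreover have "schur_norm V W u' \<le> schur_norm V W (tmat_dsum V W u u')"
    by (rule compress [OF u', of m]) (simp_all add: dsum(2))
  ultimately show "max (schur_norm V W u) (schur_norm V W u') \<le> schur_norm V W (tmat_dsum V W u u')"
    by simp
qed

lemma schur_norm_tmat_sandwich_le:
  assumes u: "u \<in> matrices m (tensor_product V W)"
    and \<gamma>: "\<gamma> \<in> carrier_mat p m" and \<delta>: "\<delta> \<in> carrier_mat m p"
  shows "schur_norm V W (tmat_sandwich V W \<gamma> u \<delta>) \<le> cmat_norm \<gamma> * schur_norm V W u * cmat_norm \<delta>"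
proof (rule schur_norm_sandwich_le [OF u _ cmat_norm_l2_bound(1) [OF \<gamma>] cmat_norm_l2_bound(1) [OF \<delta>]])
  show "tmat_sandwich V W \<gamma> u \<delta> \<in> matrices p (tensor_product V W)"
    using \<gamma> \<delta> by (intro matricesI tmat_sandwich_index [OF u]) (auto simp: tmat_sandwich_def)
qed (rule tmat_sandwich_index(2) [OF u \<gamma> \<delta>])

end

theorem theorem2p1:
  fixes V :: "('h :: chilbert_space \<Rightarrow>\<^sub>L 'h) set"
    and W :: "('k :: chilbert_space \<Rightarrow>\<^sub>L 'k) set"
  assumes "operator_space V" and "operator_space W"
  shows "operator_space_matrix_norm V W (schur_norm V W)"
proof -
  have V: "complex_module.subspace V" and W: "complex_module.subspace W" and ops: "V \<subseteq> bounded_operators"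
    using assms by (simp_all add: operator_space_def)
  interpret tensor_of_subspaces V W
    by (rule tensor_of_subspaces.intro [OF V W])
  show ?thesis
    unfolding operator_space_matrix_norm_def norm_on_tensor_matrices_def
    using schur_norm_nonneg schur_norm_zero schur_norm_eq_zero_imp [OF _ ops] schur_norm_scale
      schur_norm_triangle schur_norm_dsum schur_norm_tmat_sandwich_le
    by blast
qed

end
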